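(* Let $\mathbb F$ be an algebraically closed field and let $q\in\mathbb F$ be nonzero and not a root of unity. Let $V$ denote an evaluation module for $\boxtimes_q$, with diameter $d$ and evaluation parameter $t$. Let $\eta_i\in V$, $\eta^*_i\in V^*$ $(i\in\mathbb Z_4)$ be nonzero vectors in component $0$ of the flag $[i]$ on $V$, respectively $V^*$, and consider the 24 bases $[i,j,k,\ell]$ for $V$ normalized via the $\eta_j$. The following table displays some transition matrices between these bases; each is diagonal. Pick $r\in\mathbb Z_4$, and first assume that $r$ is even. $$\begin{array}{c|c}\text{transition}&\text{transition matrix}\\ \hline [r,r+1,r+2,r+3]\to[r+1,r,r+2,r+3]&D_q(t)\,\frac{(\eta_r,\eta^*_{r+3})}{(\eta_{r+1},\eta^*_{r+3})}\\ [r+1,r,r+2,r+3]\to[r,r+1,r+2,r+3]&(D_q(t))^{-1}\,\frac{(\eta_{r+1},\eta^*_{r+3})}{(\eta_r,\eta^*_{r+3})}\\ [r,r+1,r+3,r+2]\to[r+1,r,r+3,r+2]&(D_{q^{-1}}(t))^{-1}\,\frac{(\eta_r,\eta^*_{r+2})}{(\eta_{r+1},\eta^*_{r+2})}\\ [r+1,r,r+3,r+2]\to[r,r+1,r+3,r+2]&D_{q^{-1}}(t)\,\frac{(\eta_{r+1},\eta^*_{r+2})}{(\eta_r,\eta^*_{r+2})}\\ [r,r+2,r+1,r+3]\to[r+2,r,r+1,r+3]&\mathcal D_q(t)\,\frac{(\eta_r,\eta^*_{r+3})}{(\eta_{r+2},\eta^*_{r+3})}\\ [r+2,r,r+1,r+3]\to[r,r+2,r+1,r+3]&(\mathcal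 D_q(t))^{-1}\,\frac{(\eta_{r+2},\eta^*_{r+3})}{(\eta_r,\eta^*_{r+3})}\end{array}$$ Next assume that $r$ is odd. Then the same table holds with $t$ replaced by $t^{-1}$.
   Context: Algebras are associative with 1. $[n]_q=(q^n-q^{-n})/(q-q^{-1})$, $\mathbb Z_4=\mathbb Z/4\mathbb Z$, and $(a;q)_n=(1-a)(1-aq)\cdots(1-aq^{n-1})$. The $q$-tetrahedron algebra $\boxtimes_q$ is the $\mathbb F$-algebra with generators (called the standard generators) $\{x_{ij}\mid i,j\in\mathbb Z_4,\ j-i=1\text{ or }j-i=2\}$ and relations: (i) $x_{ij}x_{ji}=1$ if $j-i=2$; (ii) $\frac{qx_{ij}x_{jk}-q^{-1}x_{jk}x_{ij}}{q-q^{-1}}=1$ if $(j-i,k-j)$ is one of $(1,1),(1,2),(2,1)$; (iii) $x_{ij}^3x_{k\ell}-[3]_qx_{ij}^2x_{k\ell}x_{ij}+[3]_qx_{ij}x_{k\ell}x_{ij}^2-x_{k\ell}x_{ij}^3=0$ if $j-i=k-j=\ell-k=1$. Known fact: on a finite-dimensional irreducible $\boxtimes_q$-module $V$ there are $d\in\mathbb N$ (the diameter) and $\varepsilon\in\{1,-1\}$ (the type) such that each standard generator is diagonalizable with set of distinct eigenvalues $\{\varepsilon q^{d-2n}\mid 0\le n\le d\}$. Let $V$ have type 1. For distinct $i,j\in\mathbb Z_4$ the decomposition $[i,j]$ of $V$ is the sequence of subspaces $\{V_n\}_{n=0}^d$ (with $V=\bigoplus_n V_n$) such that: if $j-i\in\{1,2\}$,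 $V_n$ is the eigenspace of $x_{ij}$ with eigenvalue $q^{d-2n}$; if $j-i=3$, $[i,j]$ is the inversion (reversed sequence) of $[j,i]$. The shape $(\dim V_n)_{n=0}^d$ does not depend on $i,j$. For $i\in\mathbb Z_4$ the flag $[i]$ on $V$ has $n$th component $V_0+\cdots+V_n$, where $\{V_n\}$ is the decomposition $[i,j]$; this is known not to depend on $j\ne i$. The trivial $\boxtimes_q$-module is the one-dimensional module on which every standard generator acts as the identity. An evaluation module for $\boxtimes_q$ is a nontrivial finite-dimensional irreducible $\boxtimes_q$-module of type 1 and shape $(1,1,\dots,1)$ (so $d\ge1$, $\dim V=d+1$). Dual space: $V^*$ is the space of linear maps $V\to\mathbb F$, $(u,f)=f(u)$ for $u\in V,f\in V^*$. $V^*$ is a $\boxtimes_{q^{-1}}$-module in which each standard generator $x_{ij}$ of $\boxtimes_{q^{-1}}$ acts as the adjoint of $x_{ij}$ on $V$: $(x_{ij}u,v)=(u,x_{ij}v)$. This module is again an evaluation module (for $\boxtimes_{q^{-1}}$) of diameter $d$. For distinct $i,j\in\mathbb Z_4$ the decomposition $[i,j]$ of $V^*$ is the sequence of subspaces $\{W_n\}_{n=0}^d$ (with $V^*=\bigoplus_n W_n$) such that: if $j-i\in\{1,2\}$, $W_n$ is the eigenspace of $x_{ij}$ on $V^*$ with eigenvalue $q^{2n-d}$; if $j-i=3$, the decomposition $[i,j]$ of $V^*$ is the inversion of the decomposition $[j,i]$ of $V^*$. For $i\in\mathbb Z_4$ the flag $[i]$ on $V^*$ has $n$th component $W_0+\cdots+W_n$,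 where $\{W_n\}$ is the decomposition $[i,j]$ of $V^*$; this does not depend on $j\ne i$. In particular $\eta_i$ satisfies $x_{i,i+1}\eta_i=q^d\eta_i$ and $\eta_i^*$ satisfies $x_{i,i+1}\eta^*_i=q^{-d}\eta^*_i$. One has $(\eta_i,\eta_j^* )\ne0$ for $i\ne j$. Normalized bases: for mutually distinct $i,j,k,\ell\in\mathbb Z_4$, $[i,j,k,\ell]$ denotes the unique basis $\{u_n\}_{n=0}^d$ of $V$ such that $u_n$ is in component $n$ of the decomposition $[k,\ell]$ of $V$ for $0\le n\le d$, and $\eta_j=\sum_{n=0}^du_n$. The transition matrix from a basis $\{u_n\}$ to a basis $\{v_n\}$ is the matrix $S$ with $v_n=\sum_{r=0}^dS_{rn}u_r$. Matrices in ${\rm Mat}_{d+1}(\mathbb F)$ have rows and columns indexed by $0,\dots,d$; $M$ represents $A$ with respect to $\{v_n\}_{n=0}^d$ when $Av_n=\sum_i M_{in}v_i$. Entries not mentioned below are $0$. A subscript $q^{-1}$ means that $q$ is replaced by $q^{-1}$ in the definition (and similarly $t^{-1}$ as argument). - $D_q(t)$: diagonal, $(i,i)$-entry $(tq^{d-2i+1};q^2)_i$. - $\mathcal D_q(t)$: diagonal, $(i,i)$-entry $t^iq^{i(d-1)}$. - $Z$: $(i,j)$-entry $\delta_{i+j,d}$. - $K_q$: diagonal, $(i,i)$-entry $q^{d-2i}$. - $E_q$: $(i,i)$-entry $q^{2i-d}$; $(i-1,i)$-entry $q^d-q^{2i-2-d}$. - $G_q(t)$: $(i,i)$-entry $q^{2i-d}$;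 $(i-1,i)$-entry $(q^d-q^{2i-2-d})(1-tq^{d-2i+1})$. - $L_q(t)$: $(i,i)$-entry $q^{2i-d}$; $(i-1,i)$-entry $(q^d-q^{2i-2-d})(1-tq^{d-2i+1})^{-1}$. - $S_q(t)$: $(i-1,i)$-entry $(q^d-q^{2i-d-2})(1-tq^{2i-d-1})$; $(i,i-1)$-entry $(q^{2i-d}-q^{-d})q^{2i-d-1}t$; $(i,i)$-entry $q^d-(q^{2i-d}-q^{-d})q^{2i-d-1}t-(q^d-q^{2i-d})(1-tq^{2i-d+1})$. For an integer $d\ge1$ and a nonzero $t\in\mathbb F$ not among $\{q^{d-2n+1}\}_{n=1}^d$, $\mathbf V_d(t)$ is the evaluation module for $\boxtimes_q$ having a basis with respect to which the standard generators are represented by: $x_{01}: ZS_{q^{-1}}(t^{-1})Z$, $x_{12}: E_q$, $x_{23}: K_q$, $x_{30}: ZG_{q^{-1}}(t)Z$, $x_{02}: L_q(t)$, $x_{13}: (ZE_{q^{-1}}Z)^{-1}$, $x_{20}: (L_q(t))^{-1}$, $x_{31}: ZE_{q^{-1}}Z$. Every evaluation module $V$ of diameter $d$ is isomorphic to $\mathbf V_d(t)$ for a unique such $t$, called the evaluation parameter of $V$. "$r\in\mathbb Z_4$ even" means $r\in\{0,2\}$. *)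

theory Defs
  imports
    "HOL-Library.Numeral_Type"
    "HOL-Library.Function_Algebras"
    "HOL-Computational_Algebra.Polynomial"
    "Jordan_Normal_Form.Gauss_Jordan_Elimination"
begin

text \<open>The type \<open>4\<close> of \<open>HOL-Library.Numeral_Type\<close> is the ring of integers modulo 4.\<close>

definition standard_pair :: "4 \<Rightarrow> 4 \<Rightarrow> bool" where
  "standard_pair i j \<longleftrightarrow> j - i = 1 \<or> j - i = 2"

definition qint :: "'f::field \<Rightarrow> nat \<Rightarrow> 'f" where
  "qint q n = (q ^ n - inverse q ^ n) / (q - inverse q)"

definition qpoch :: "'f::field \<Rightarrow> 'f \<Rightarrow> nat \<Rightarrow> 'f" where
  "qpoch a q n = (\<Prod>k<n. 1 - a * q ^ k)"


section \<open>Modules for the q-tetrahedron algebra\<close>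

text \<open>
  The q-tetrahedron algebra is given by generators and relations, so a module for it is a
  vector space (here: all of the type \<open>'v\<close>) together with one linear operator \<open>x i j\<close>
  for each standard generator, subject to the defining relations. The operators \<open>x i j\<close>
  with \<open>\<not> standard_pair i j\<close> carry no meaning.
\<close>

locale qtet_module = vector_space scale
  for scale :: "'f::field \<Rightarrow> 'v::ab_group_add \<Rightarrow> 'v" (infixr \<open>*s\<close> 75) +
  fixes q :: 'f and x :: "4 \<Rightarrow> 4 \<Rightarrow> 'v \<Rightarrow> 'v"
  assumes x_linear:
      "standard_pair i j \<Longrightarrow> Vector_Spaces.linear scale scale (x i j)"
    and x_inverse:
      "j - i = 2 \<Longrightarrow> x i j (x j i v) = v"
    and x_weyl:
      "(j - i, k - j) \<in> {(1, 1), (1, 2), (2, 1)} \<Longrightarrow>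
         inverse (q - inverse q) *s (q *s x i j (x j k v) - inverse q *s x j k (x i j v)) = v"
    and x_serre:
      "j - i = 1 \<Longrightarrow> k - j = 1 \<Longrightarrow> l - k = 1 \<Longrightarrow>
         x i j (x i j (x i j (x k l v)))
         - qint q 3 *s x i j (x i j (x k l (x i j v)))
         + qint q 3 *s x i j (x k l (x i j (x i j v)))
         - x k l (x i j (x i j (x i j v))) = 0"
begin

definition finite_dim :: bool where
  "finite_dim \<longleftrightarrow> (\<exists>B. finite B \<and> span B = UNIV)"

text \<open>Invariance under the generators is invariance under the whole algebra.\<close>

definition irreducible_module :: bool where
  "irreducible_module \<longleftrightarrow>
     (UNIV :: 'v set) \<noteq> {0} \<and>
     (\<forall>W. subspace W \<and> (\<forall>i j. standard_pair i j \<longrightarrow> x i j ` W \<subseteq> W) \<longrightarrow>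
        W = {0} \<or> W = UNIV)"

definition trivial_module :: bool where
  "trivial_module \<longleftrightarrow>
     dim (UNIV :: 'v set) = 1 \<and> (\<forall>i j v. standard_pair i j \<longrightarrow> x i j v = v)"

definition diagonalizable :: "('v \<Rightarrow> 'v) \<Rightarrow> bool" where
  "diagonalizable T \<longleftrightarrow>
     (\<exists>B. independent B \<and> span B = UNIV \<and> (\<forall>b\<in>B. \<exists>c. T b = c *s b))"

definition eigenvalues_of :: "('v \<Rightarrow> 'v) \<Rightarrow> 'f set" where
  "eigenvalues_of T = {c. \<exists>v. v \<noteq> 0 \<and> T v = c *s v}"

definition has_diameter_type :: "nat \<Rightarrow> 'f \<Rightarrow> bool" where
  "has_diameter_type d \<epsilon> \<longleftrightarrow>
     \<epsilon> \<in> {1, - 1} \<and>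
     (\<forall>i j. standard_pair i j \<longrightarrow>
        diagonalizable (x i j) \<and>
        eigenvalues_of (x i j) = {\<epsilon> * q powi (int d - 2 * int n) | n. n \<le> d})"

end


section \<open>Decompositions and flags\<close>

text \<open>
  These notions are needed both for a module \<open>V\<close> and for its dual, so the underlying vector
  space is an arbitrary set \<open>W\<close> with scalar multiplication \<open>scl\<close>.
\<close>

definition eigenspace_on ::
  "'w set \<Rightarrow> ('f \<Rightarrow> 'w \<Rightarrow> 'w) \<Rightarrow> ('w \<Rightarrow> 'w) \<Rightarrow> 'f \<Rightarrow> 'w set" where
  "eigenspace_on W scl T c = {w \<in> W. T w = scl c w}"

text \<open>
  Component \<open>n\<close> of the decomposition \<open>[i,j]\<close>, for distinct \<open>i\<close>, \<open>j\<close>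
  and \<open>n \<le> d\<close>. The second branch is the case \<open>j - i = 3\<close>, that is,
  \<open>i - j = 1\<close>.
\<close>

definition decomposition ::
  "'w set \<Rightarrow> ('f::field \<Rightarrow> 'w \<Rightarrow> 'w) \<Rightarrow> 'f \<Rightarrow> (4 \<Rightarrow> 4 \<Rightarrow> 'w \<Rightarrow> 'w) \<Rightarrow> nat
     \<Rightarrow> 4 \<Rightarrow> 4 \<Rightarrow> nat \<Rightarrow> 'w set" where
  "decomposition W scl q x d i j n =
     (if standard_pair i j
      then eigenspace_on W scl (x i j) (q powi (int d - 2 * int n))
      else eigenspace_on W scl (x j i) (q powi (int d - 2 * int (d - n))))"

text \<open>
  Component \<open>n\<close> of the flag \<open>[i]\<close>. It can be computed from \<open>[i,j]\<close> for any
  \<open>j \<noteq> i\<close>, with the same result; we use \<open>j = i + 1\<close>.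
\<close>

definition flag ::
  "'w::ab_group_add set \<Rightarrow> ('f::field \<Rightarrow> 'w \<Rightarrow> 'w) \<Rightarrow> 'f \<Rightarrow> (4 \<Rightarrow> 4 \<Rightarrow> 'w \<Rightarrow> 'w)
     \<Rightarrow> nat \<Rightarrow> 4 \<Rightarrow> nat \<Rightarrow> 'w set" where
  "flag W scl q x d i n =
     {\<Sum>m\<le>n. w m | w. \<forall>m\<le>n. w m \<in> decomposition W scl q x d i (i + 1) m}"

definition dual_space :: "('f::field \<Rightarrow> 'v::ab_group_add \<Rightarrow> 'v) \<Rightarrow> ('v \<Rightarrow> 'f) set" where
  "dual_space scale = {f. Vector_Spaces.linear scale (*) f}"

definition dual_scale :: "'f::field \<Rightarrow> ('v \<Rightarrow> 'f) \<Rightarrow> 'v \<Rightarrow> 'f" where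
  "dual_scale c f = (\<lambda>u. c * f u)"

definition dual_action :: "(4 \<Rightarrow> 4 \<Rightarrow> 'v \<Rightarrow> 'v) \<Rightarrow> 4 \<Rightarrow> 4 \<Rightarrow> ('v \<Rightarrow> 'f) \<Rightarrow> 'v \<Rightarrow> 'f" where
  "dual_action x i j f = (\<lambda>u. f (x i j u))"

definition V_flag ::
  "('f::field \<Rightarrow> 'v::ab_group_add \<Rightarrow> 'v) \<Rightarrow> 'f \<Rightarrow> (4 \<Rightarrow> 4 \<Rightarrow> 'v \<Rightarrow> 'v)
     \<Rightarrow> nat \<Rightarrow> 4 \<Rightarrow> nat \<Rightarrow> 'v set" where
  "V_flag scale q x d = flag UNIV scale q x d"

text \<open>
  The dual is a module for the parameter \<open>inverse q\<close>, so the eigenvalues defining its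
  decompositions are \<open>inverse q powi (d - 2 n) = q powi (2 n - d)\<close>.
\<close>

definition dual_flag ::
  "('f::field \<Rightarrow> 'v::ab_group_add \<Rightarrow> 'v) \<Rightarrow> 'f \<Rightarrow> (4 \<Rightarrow> 4 \<Rightarrow> 'v \<Rightarrow> 'v)
     \<Rightarrow> nat \<Rightarrow> 4 \<Rightarrow> nat \<Rightarrow> ('v \<Rightarrow> 'f) set" where
  "dual_flag scale q x d =
     flag (dual_space scale) dual_scale (inverse q) (dual_action x) d"


section \<open>Evaluation modules\<close>

locale evaluation_module = qtet_module scale q x
  for scale :: "'f::field \<Rightarrow> 'v::ab_group_add \<Rightarrow> 'v" (infixr \<open>*s\<close> 75)
    and q :: 'f and x :: "4 \<Rightarrow> 4 \<Rightarrow> 'v \<Rightarrow> 'v" +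
  fixes d :: nat
  assumes finite_dimensional: finite_dim
    and irreducible: irreducible_module
    and nontrivial: "\<not> trivial_module"
    and type_1: "has_diameter_type d 1"
    and shape_1: "i \<noteq> j \<Longrightarrow> n \<le> d \<Longrightarrow> dim (decomposition UNIV scale q x d i j n) = 1"


section \<open>Matrices\<close>

text \<open>
  All matrices are square of size \<open>d + 1\<close>. In the formulas below, an \<open>(i-1,i)\<close>-entry is
  written in terms of its column index \<open>j = i\<close>, an \<open>(i,i-1)\<close>-entry in terms of its row
  index \<open>i\<close>.
\<close>

definition mat_inv :: "'f::field mat \<Rightarrow> 'f mat" where
  "mat_inv A = the (mat_inverse A)"

definition D_mat :: "nat \<Rightarrow> 'f::field \<Rightarrow> 'f \<Rightarrow> 'f mat" where
  "D_mat d q t = mat (d + 1) (d + 1) (\<lambda>(i, j).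
     if i = j then qpoch (t * q powi (int d - 2 * int i + 1)) (q ^ 2) i else 0)"

definition calD_mat :: "nat \<Rightarrow> 'f::field \<Rightarrow> 'f \<Rightarrow> 'f mat" where
  "calD_mat d q t = mat (d + 1) (d + 1) (\<lambda>(i, j).
     if i = j then t ^ i * q powi (int i * (int d - 1)) else 0)"

definition Z_mat :: "nat \<Rightarrow> 'f::field mat" where
  "Z_mat d = mat (d + 1) (d + 1) (\<lambda>(i, j). if i + j = d then 1 else 0)"

definition K_mat :: "nat \<Rightarrow> 'f::field \<Rightarrow> 'f mat" where
  "K_mat d q = mat (d + 1) (d + 1) (\<lambda>(i, j).
     if i = j then q powi (int d - 2 * int i) else 0)"

definition E_mat :: "nat \<Rightarrow> 'f::field \<Rightarrow> 'f mat" where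
  "E_mat d q = mat (d + 1) (d + 1) (\<lambda>(i, j).
     if i = j then q powi (2 * int i - int d)
     else if j = i + 1 then q ^ d - q powi (2 * int j - 2 - int d)
     else 0)"

definition G_mat :: "nat \<Rightarrow> 'f::field \<Rightarrow> 'f \<Rightarrow> 'f mat" where
  "G_mat d q t = mat (d + 1) (d + 1) (\<lambda>(i, j).
     if i = j then q powi (2 * int i - int d)
     else if j = i + 1 then
       (q ^ d - q powi (2 * int j - 2 - int d)) * (1 - t * q powi (int d - 2 * int j + 1))
     else 0)"

definition L_mat :: "nat \<Rightarrow> 'f::field \<Rightarrow> 'f \<Rightarrow> 'f mat" where
  "L_mat d q t = mat (d + 1) (d + 1) (\<lambda>(i, j).
     if i = j then q powi (2 * int i - int d)
     else if j = i + 1 then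
       (q ^ d - q powi (2 * int j - 2 - int d)) * inverse (1 - t * q powi (int d - 2 * int j + 1))
     else 0)"

definition S_mat :: "nat \<Rightarrow> 'f::field \<Rightarrow> 'f \<Rightarrow> 'f mat" where
  "S_mat d q t = mat (d + 1) (d + 1) (\<lambda>(i, j).
     if j = i + 1 then
       (q ^ d - q powi (2 * int j - int d - 2)) * (1 - t * q powi (2 * int j - int d - 1))
     else if i = j + 1 then
       (q powi (2 * int i - int d) - q powi (- int d)) * q powi (2 * int i - int d - 1) * t
     else if i = j then
       q ^ d
       - (q powi (2 * int i - int d) - q powi (- int d)) * q powi (2 * int i - int d - 1) * t
       - (q ^ d - q powi (2 * int i - int d)) * (1 - t * q powi (2 * int i - int d + 1))
     else 0)"


section \<open>Bases\<close>

definition is_basis :: "('f::field \<Rightarrow> 'v::ab_group_add \<Rightarrow> 'v) \<Rightarrow> 'v list \<Rightarrow> bool" where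
  "is_basis scale vs \<longleftrightarrow>
     distinct vs \<and> \<not> module.dependent scale (set vs) \<and> module.span scale (set vs) = UNIV"

definition represents ::
  "('f::field \<Rightarrow> 'v::ab_group_add \<Rightarrow> 'v) \<Rightarrow> 'v list \<Rightarrow> 'f mat \<Rightarrow> ('v \<Rightarrow> 'v) \<Rightarrow> bool" where
  "represents scale vs M A \<longleftrightarrow>
     M \<in> carrier_mat (length vs) (length vs) \<and>
     (\<forall>n<length vs. A (vs ! n) = (\<Sum>i<length vs. scale (M $$ (i, n)) (vs ! i)))"

definition is_transition_matrix ::
  "('f::field \<Rightarrow> 'v::ab_group_add \<Rightarrow> 'v) \<Rightarrow> 'v list \<Rightarrow> 'v list \<Rightarrow> 'f mat \<Rightarrow> bool" where
  "is_transition_matrix scale us vs S \<longleftrightarrow>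
     is_basis scale us \<and> is_basis scale vs \<and> length us = length vs \<and>
     S \<in> carrier_mat (length us) (length us) \<and>
     (\<forall>n<length us. vs ! n = (\<Sum>r<length us. scale (S $$ (r, n)) (us ! r)))"

text \<open>
  \<open>t\<close> is the evaluation parameter of \<open>V\<close> if \<open>V\<close> is isomorphic to the module
  \<open>V_d(t)\<close>, i.e. if \<open>V\<close> has a basis on which the generators act by the matrices that
  define \<open>V_d(t)\<close>.
\<close>

definition evaluation_parameter ::
  "('f::field \<Rightarrow> 'v::ab_group_add \<Rightarrow> 'v) \<Rightarrow> 'f \<Rightarrow> (4 \<Rightarrow> 4 \<Rightarrow> 'v \<Rightarrow> 'v) \<Rightarrow> nat \<Rightarrow> 'f \<Rightarrow> bool" where
  "evaluation_parameter scale q x d t \<longleftrightarrow>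
     t \<noteq> 0 \<and> (\<forall>n\<in>{1..d}. t \<noteq> q powi (int d - 2 * int n + 1)) \<and>
     (\<exists>vs. length vs = d + 1 \<and> is_basis scale vs \<and>
        represents scale vs (Z_mat d * S_mat d (inverse q) (inverse t) * Z_mat d) (x 0 1) \<and>
        represents scale vs (E_mat d q) (x 1 2) \<and>
        represents scale vs (K_mat d q) (x 2 3) \<and>
        represents scale vs (Z_mat d * G_mat d (inverse q) t * Z_mat d) (x 3 0) \<and>
        represents scale vs (L_mat d q t) (x 0 2) \<and>
        represents scale vs (mat_inv (Z_mat d * E_mat d (inverse q) * Z_mat d)) (x 1 3) \<and>
        represents scale vs (mat_inv (L_mat d q t)) (x 2 0) \<and>
        represents scale vs (Z_mat d * E_mat d (inverse q) * Z_mat d) (x 3 1))"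

text \<open>
  The basis \<open>[i,j,k,l]\<close> for mutually distinct \<open>i\<close>, \<open>j\<close>, \<open>k\<close>,
  \<open>l\<close>. The index \<open>i\<close> is determined by the other three and does not occur on the
  right-hand side.
\<close>

definition normalized_basis ::
  "('f::field \<Rightarrow> 'v::ab_group_add \<Rightarrow> 'v) \<Rightarrow> 'f \<Rightarrow> (4 \<Rightarrow> 4 \<Rightarrow> 'v \<Rightarrow> 'v) \<Rightarrow> nat \<Rightarrow> (4 \<Rightarrow> 'v)
     \<Rightarrow> 4 \<Rightarrow> 4 \<Rightarrow> 4 \<Rightarrow> 4 \<Rightarrow> 'v list" where
  "normalized_basis scale q x d \<eta> i j k l =
     (THE us. length us = d + 1 \<and> is_basis scale us \<and>
        (\<forall>n\<le>d. us ! n \<in> decomposition UNIV scale q x d k l n) \<and>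
        \<eta> j = (\<Sum>n\<le>d. us ! n))"

end

theory Submission
  imports Defs
begin

text \<open>
  Let \<open>(j,k,l)\<close> be distinct with differences \<open>1,1,2\<close> in some cyclic order. Then
  \<open>x j k\<close>, \<open>x k l\<close>, \<open>x l j\<close> are standard generators, any two cyclically
  consecutive ones satisfy a q-Weyl relation, and these relations make \<open>x j k\<close> upper
  bidiagonal and \<open>x l j\<close> lower bidiagonal with respect to the decomposition \<open>[k,l]\<close>.
  The vector \<open>\<eta> j\<close> is an eigenvector of both. Comparing components therefore determines
  how both operators act on the components of \<open>\<eta> j\<close> in \<open>[k,l]\<close>
  (\<open>raise_components\<close>, \<open>lower_components\<close>) and shows that no component
  vanishes (\<open>components_nonzero\<close>). Hence the two bases in a row of the table consist of
  multiples of each other, term by term, and it remains to find the first of these scalars and the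
  ratios of consecutive ones.

  The ratios come from one further relation, which contains the evaluation parameter: the operator
  \<open>(q - q\<^sup>-\<^sup>1) s (x r (r + 1) - x (r + 2) (r + 3))\<close> is the commutator of
  \<open>x (r + 3) r\<close> and \<open>x (r + 1) (r + 2)\<close>,
  where \<open>s = t\<close> for even \<open>r\<close> and \<open>s = t\<^sup>-\<^sup>1\<close> for odd \<open>r\<close>. It does not change
  under \<open>r \<mapsto> r + 2\<close>, so the matrices defining the evaluation parameter are needed only for
  \<open>r = 0\<close> and \<open>r = 1\<close> (\<open>evaluation_relations_of_parameter\<close>), and everything
  else is uniform in \<open>r\<close>; the inversion of \<open>t\<close> for odd \<open>r\<close> in the theorem is the
  one in this relation. The relation for \<open>r\<close> gives the ratios in the first four rows
  (\<open>adjacent_flag_ratio\<close>), the relation for \<open>r + 1\<close> those in the last two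
  (\<open>opposite_flag_ratio\<close>).

  The first scalar is read off with \<open>\<eta>s l\<close>: as an eigenvector of the transposed generators it
  vanishes on all components of \<open>[k,l]\<close> except the first, so its values on the two flag
  vectors are in the ratio of their first components.
\<close>

section \<open>Index arithmetic modulo 4\<close>

text \<open>
  Equivalently, the differences \<open>j - i\<close>, \<open>k - j\<close>, \<open>i - k\<close> are
  \<open>1,1,2\<close> in some order, which is why the notion is invariant under rotation.
\<close>

definition weyl_triple :: "4 \<Rightarrow> 4 \<Rightarrow> 4 \<Rightarrow> bool" where
  "weyl_triple i j k \<longleftrightarrow> (j - i, k - j) \<in> {(1, 1), (1, 2), (2, 1)}"

lemma weyl_triple_cases:
  assumes "weyl_triple i j k"
  obtains "j = i + 1" "k = i + 2" | "j = i + 1" "k = i + 3" | "j = i + 2" "k = i + 3"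
proof -
  define a b where "a = j - i" and "b = k - j"
  have "j = i + a" "k = i + (a + b)" by (simp_all add: a_def b_def)
  moreover have "(a, b) \<in> {(1, 1), (1, 2), (2, 1)}"
    using assms by (simp add: weyl_triple_def a_def b_def)
  ultimately show thesis using that by (elim insertE Pair_inject emptyE) simp_all
qed

lemma weyl_triple_standard:
  assumes "weyl_triple i j k"
  shows "standard_pair i j" "standard_pair j k" "standard_pair k i"
  using assms by (cases rule: weyl_triple_cases; simp add: standard_pair_def)+

lemma weyl_triple_rotate:
  assumes "weyl_triple i j k"
  shows "weyl_triple j k i"
  using assms by (cases rule: weyl_triple_cases) (simp_all add: weyl_triple_def)

lemma z4_exhaust: "(r::4) = 0 \<or> r = 1 \<or> r = 2 \<or> r = 3"
proof (cases r rule: bit0_cases)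
  fix z :: int
  assume *: "r = of_int z" "0 \<le> z" "z < int CARD(2 bit0)"
  then have "z = 0 \<or> z = 1 \<or> z = 2 \<or> z = 3" by auto
  with * show ?thesis by auto
qed

lemma z4_wrap:
  fixes r :: 4
  shows "r + 4 = r" "r + 5 = r + 1" "r + 6 = r + 2"
  by simp_all

section \<open>The Weyl relations\<close>

locale generic_evaluation_module = evaluation_module scale q x d
  for scale :: "'f::field \<Rightarrow> 'v::ab_group_add \<Rightarrow> 'v" (infixr \<open>*s\<close> 75)
    and q :: 'f and x :: "4 \<Rightarrow> 4 \<Rightarrow> 'v \<Rightarrow> 'v" and d :: nat +
  assumes q_nonzero: "q \<noteq> 0"
    and q_not_root_of_unity: "n > 0 \<Longrightarrow> q ^ n \<noteq> 1"
begin

lemma q_powi_eq_1_iff: "q powi z = 1 \<longleftrightarrow> z = 0"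
proof
  assume z: "q powi z = 1"
  have "q ^ nat \<bar>z\<bar> = 1"
  proof (cases "z \<ge> 0")
    case True
    then show ?thesis using z by (simp add: power_int_nonneg_exp)
  next
    case False
    then have "q powi (- z) = 1" using z by (simp add: power_int_minus)
    then show ?thesis using False by (simp add: power_int_nonneg_exp)
  qed
  then show "z = 0" using q_not_root_of_unity[of "nat \<bar>z\<bar>"] by auto
qed simp

lemma q_powi_inject: "q powi a = q powi b \<longleftrightarrow> a = b"
proof -
  have "q powi a = q powi b \<longleftrightarrow> q powi (a - b) = 1"
    using q_nonzero by (auto simp: power_int_diff)
  then show ?thesis by (simp add: q_powi_eq_1_iff)
qed

lemma q_powi_double: "q powi (2 * z) = (q powi z)\<^sup>2"
  using power_int_mult[of q z 2] by (simp add: mult.commute)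

lemmas q_powi_expand = power_int_add power_int_diff power_int_minus q_powi_double

lemma q_minus_inverse_nonzero: "q - inverse q \<noteq> 0"
proof
  assume "q - inverse q = 0"
  then have "q ^ 2 = 1"
    using q_nonzero by (simp add: power2_eq_square field_simps)
  then show False using q_not_root_of_unity[of 2] by simp
qed

lemma x_hom: "standard_pair i j \<Longrightarrow> module_hom scale scale (x i j)"
  using x_linear linear_iff_module_hom by metis

lemmas x_add = module_hom.add[OF x_hom]
  and x_diff = module_hom.diff[OF x_hom]
  and x_scale = module_hom.scale[OF x_hom]
  and x_sum = module_hom.sum[OF x_hom]
  and x_zero = module_hom.zero[OF x_hom]

lemma weyl_relation:
  assumes "weyl_triple i j k"
  shows "q *s x i j (x j k v) - inverse q *s x j k (x i j v) = (q - inverse q) *s v"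
proof -
  have "(q - inverse q) *s (inverse (q - inverse q) *s
      (q *s x i j (x j k v) - inverse q *s x j k (x i j v))) = (q - inverse q) *s v"
    using x_weyl[of j i k v] assms unfolding weyl_triple_def by simp
  then show ?thesis
    using q_minus_inverse_nonzero by simp
qed

section \<open>Eigenspaces of the standard generators\<close>

text \<open>
  Indexing by all integers, with zero spaces outside \<open>0..d\<close>, lets operators that shift the
  index be treated without boundary cases.
\<close>

definition eig :: "4 \<Rightarrow> 4 \<Rightarrow> int \<Rightarrow> 'v set" where
  "eig k l z = {v. x k l v = q powi (int d - 2 * z) *s v}"

lemma eigD: "v \<in> eig k l z \<Longrightarrow> x k l v = q powi (int d - 2 * z) *s v"
  by (simp add: eig_def)

lemma subspace_eig:
  assumes "standard_pair k l"
  shows "subspace (eig k l z)"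
  unfolding subspace_def eig_def
  using assms by (auto simp: x_add x_scale x_zero scale_right_distrib scale_left_commute)

lemma eig_outside:
  assumes "standard_pair k l" "z \<notin> {0..int d}" "v \<in> eig k l z"
  shows "v = 0"
proof (rule ccontr)
  assume "v \<noteq> 0"
  then have "q powi (int d - 2 * z) \<in> eigenvalues_of (x k l)"
    using assms(3) by (auto simp: eigenvalues_of_def eig_def)
  then obtain n where "n \<le> d" "q powi (int d - 2 * z) = q powi (int d - 2 * int n)"
    using type_1 assms(1) unfolding has_diameter_type_def by auto
  then have "z = int n" by (simp add: q_powi_inject)
  with \<open>n \<le> d\<close> assms(2) show False by simp
qed

text \<open>
  The usual induction for eigenvectors to distinct eigenvalues: applying \<open>x k l\<close> minus one
  of the eigenvalues removes one summand and rescales the others.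
\<close>

lemma eig_sum_zero:
  assumes "standard_pair k l" "finite A"
    and "\<And>z. z \<in> A \<Longrightarrow> u z \<in> eig k l z" and "(\<Sum>z\<in>A. u z) = 0" and "z \<in> A"
  shows "u z = 0"
  using assms(2-5)
proof (induction A arbitrary: u z rule: finite_induct)
  case empty
  then show ?case by simp
next
  case (insert a A)
  let ?c = "\<lambda>z. q powi (int d - 2 * z)"
  define w where "w z = (?c z - ?c a) *s u z" for z
  have w: "w z \<in> eig k l z" if "z \<in> A" for z
    using insert.prems(1)[of z] that subspace_scale[OF subspace_eig[OF assms(1)]]
    by (auto simp: w_def)
  have "0 = x k l (\<Sum>z\<in>insert a A. u z) - ?c a *s (\<Sum>z\<in>insert a A. u z)"
    unfolding insert.prems(2) by (simp add: x_zero[OF assms(1)])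
  also have "\<dots> = (\<Sum>z\<in>insert a A. ?c z *s u z) - (\<Sum>z\<in>insert a A. ?c a *s u z)"
    unfolding x_sum[OF assms(1)] scale_sum_right
    using insert.prems(1) by (intro arg_cong2[where f = "(-)"] sum.cong) (auto dest: eigD)
  also have "\<dots> = (\<Sum>z\<in>insert a A. w z)"
    by (simp add: w_def sum_subtractf scale_left_diff_distrib del: sum.insert)
  also have "\<dots> = (\<Sum>z\<in>A. w z)"
    using insert.hyps by (simp add: w_def)
  finally have "w z = 0" if "z \<in> A" for z
    using insert.IH[of w z] w that by simp
  then have A0: "u z = 0" if "z \<in> A" for z
    using that insert.hyps(2) by (auto simp: w_def q_powi_inject)
  then have "u a = 0"
    using insert.prems(2) insert.hyps by simp
  then show ?case using A0 insert.prems(3) by auto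
qed

definition resolves :: "4 \<Rightarrow> 4 \<Rightarrow> 'v \<Rightarrow> (int \<Rightarrow> 'v) \<Rightarrow> bool" where
  "resolves k l v u \<longleftrightarrow> (\<forall>z. u z \<in> eig k l z) \<and> v = (\<Sum>z\<in>{0..int d}. u z)"

lemma resolves_exists:
  assumes "standard_pair k l"
  shows "\<exists>u. resolves k l v u"
proof -
  have sub: "subspace (eig k l z)" for z by (rule subspace_eig[OF assms])
  obtain B where "span B = UNIV" and B: "\<And>b. b \<in> B \<Longrightarrow> \<exists>c. x k l b = c *s b"
    using type_1 assms unfolding has_diameter_type_def diagonalizable_def by blast
  then have "v \<in> span B" by simp
  then show ?thesis
  proof (induction rule: span_induct_alt)
    case base
    have "resolves k l 0 (\<lambda>z. 0)"
      using sub by (auto simp: resolves_def intro: subspace_0)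
    then show ?case by blast
  next
    case (step c b y)
    obtain u where u: "resolves k l y u" using step by blast
    obtain e where e: "x k l b = e *s b" using B step by blast
    have "\<exists>w. resolves k l b w"
    proof (cases "b = 0")
      case True
      have "resolves k l 0 (\<lambda>z. 0)"
        using sub by (auto simp: resolves_def intro: subspace_0)
      then show ?thesis using True by blast
    next
      case False
      then have "e \<in> eigenvalues_of (x k l)" using e by (auto simp: eigenvalues_of_def)
      then obtain n where n: "n \<le> d" "e = q powi (int d - 2 * int n)"
        using type_1 assms unfolding has_diameter_type_def by auto
      have "resolves k l b (\<lambda>z. if z = int n then b else 0)"
        using n e sub by (auto simp: resolves_def eig_def x_zero[OF assms])
      then show ?thesis by blast
    qed
    then obtain w where w: "resolves k l b w" ..
    have "resolves k l (c *s b + y) (\<lambda>z. c *s w z + u z)"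
      using u w sub
      by (auto simp: resolves_def sum.distrib scale_sum_right
          intro!: subspace_add subspace_scale)
    then show ?case by blast
  qed
qed

text \<open>
  This is where the shape \<open>(1,...,1)\<close> of an evaluation module enters.
\<close>

lemma eig_proportional:
  assumes "standard_pair k l" "u \<in> eig k l z" "w \<in> eig k l z" "u \<noteq> 0"
  shows "\<exists>c. w = c *s u"
proof -
  have "z \<in> {0..int d}" using eig_outside[OF assms(1) _ assms(2)] assms(4) by blast
  then obtain n where n: "z = int n" "n \<le> d"
    by (metis atLeastAtMost_iff of_nat_le_iff zero_le_imp_eq_int)
  have "k \<noteq> l" using assms(1) by (auto simp: standard_pair_def)
  then have dim1: "dim (eig k l z) = 1"
    using shape_1[of k l n] n assms(1)
    by (simp add: decomposition_def eigenspace_on_def eig_def)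
  obtain B where B: "eig k l z \<subseteq> span B" "card B = dim (eig k l z)"
    by (rule basis_exists[of "eig k l z"])
  then obtain b where b: "B = {b}" using dim1 by (metis card_1_singletonE)
  have "u \<in> span {b}" "w \<in> span {b}" using B(1) b assms(2,3) by blast+
  then obtain \<alpha> \<beta> where ab: "u = \<alpha> *s b" "w = \<beta> *s b"
    unfolding span_singleton by blast
  then have "\<alpha> \<noteq> 0" using assms(4) by auto
  then have "w = (\<beta> / \<alpha>) *s u" using ab by simp
  then show ?thesis ..
qed

section \<open>Raising and lowering operators\<close>

text \<open>
  On the eigenspace of \<open>x k l\<close> with eigenvalue \<open>\<theta>\<close>, the Weyl relation reads
  \<open>(x k l - q\<^sup>2 \<theta>) (x j k - \<theta>\<^sup>-\<^sup>1) u = 0\<close>. So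
  \<open>x j k\<close> raises the eigenvalue by \<open>q\<^sup>2\<close>, which means that it
  decreases the index \<open>z\<close>.
\<close>

lemma raise_eig:
  assumes "weyl_triple j k l" "u \<in> eig k l z"
  shows "x j k u - q powi (2 * z - int d) *s u \<in> eig k l (z - 1)"
proof -
  note st = weyl_triple_standard[OF assms(1)]
  let ?c = "q powi (int d - 2 * z)"
  have "q *s (?c *s x j k u) - inverse q *s x k l (x j k u) = (q - inverse q) *s u"
    using weyl_relation[OF assms(1), of u] eigD[OF assms(2)] st by (simp add: x_scale)
  then have "inverse q *s x k l (x j k u) = q *s (?c *s x j k u) - (q - inverse q) *s u"
    by (simp add: algebra_simps)
  then have "q *s (inverse q *s x k l (x j k u)) = q *s (q *s (?c *s x j k u) - (q - inverse q) *s u)"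
    by simp
  then have *: "x k l (x j k u) = (q\<^sup>2 * ?c) *s x j k u - (q\<^sup>2 - 1) *s u"
    using q_nonzero by (simp add: scale_right_diff_distrib power2_eq_square right_diff_distrib mult.assoc)
  have "x k l (x j k u - q powi (2 * z - int d) *s u)
      = (q\<^sup>2 * ?c) *s x j k u - (q\<^sup>2 - 1 + q powi (2 * z - int d) * ?c) *s u"
    using st eigD[OF assms(2)] *
    by (simp add: x_diff x_scale scale_left_distrib diff_diff_eq)
  also have "q\<^sup>2 * ?c = q powi (int d - 2 * (z - 1))"
    using q_nonzero by (simp add: q_powi_expand field_simps)
  also have "q\<^sup>2 - 1 + q powi (2 * z - int d) * ?c = q powi (int d - 2 * (z - 1)) * q powi (2 * z - int d)"
    using q_nonzero by (simp add: q_powi_expand field_simps)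
  finally show ?thesis
    by (simp add: eig_def scale_right_diff_distrib)
qed

text \<open>
  Here the Weyl relation reads \<open>(x k l - q\<^sup>-\<^sup>2 \<theta>) (x l j - \<theta>\<^sup>-\<^sup>1) u = 0\<close>.
\<close>

lemma lower_eig:
  assumes "weyl_triple k l j" "u \<in> eig k l z"
  shows "x l j u - q powi (2 * z - int d) *s u \<in> eig k l (z + 1)"
proof -
  note st = weyl_triple_standard[OF assms(1)]
  let ?c = "q powi (int d - 2 * z)"
  have "q *s x k l (x l j u) - inverse q *s (?c *s x l j u) = (q - inverse q) *s u"
    using weyl_relation[OF assms(1), of u] eigD[OF assms(2)] st by (simp add: x_scale)
  then have "q *s x k l (x l j u) = inverse q *s (?c *s x l j u) + (q - inverse q) *s u"
    by (simp add: algebra_simps)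
  then have "inverse q *s (q *s x k l (x l j u))
      = inverse q *s (inverse q *s (?c *s x l j u) + (q - inverse q) *s u)"
    by simp
  then have *: "x k l (x l j u) = (?c / q\<^sup>2) *s x l j u + (1 - 1 / q\<^sup>2) *s u"
    using q_nonzero
    by (simp add: scale_right_distrib power2_eq_square right_diff_distrib field_simps)
  have "x k l (x l j u - q powi (2 * z - int d) *s u)
      = (?c / q\<^sup>2) *s x l j u - (q powi (2 * z - int d) * ?c - (1 - 1 / q\<^sup>2)) *s u"
    using st eigD[OF assms(2)] *
    by (simp add: x_diff x_scale scale_left_diff_distrib)
  also have "?c / q\<^sup>2 = q powi (int d - 2 * (z + 1))"
    using q_nonzero by (simp add: q_powi_expand field_simps)
  also have "q powi (2 * z - int d) * ?c - (1 - 1 / q\<^sup>2) = q powi (int d - 2 * (z + 1)) * q powi (2 * z - int d)"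
    using q_nonzero by (simp add: q_powi_expand field_simps)
  finally show ?thesis
    by (simp add: eig_def scale_right_diff_distrib)
qed

text \<open>
  The error term \<open>x l j v - q\<^sup>-\<^sup>d v\<close> lies one step beyond the end of the decomposition
  \<open>[j,k]\<close>, so it vanishes. The next lemma is the converse passage.
\<close>

lemma eig_0_imp_eig_d:
  assumes "weyl_triple l j k" "v \<in> eig j k 0"
  shows "v \<in> eig l j (int d)"
proof -
  have "x l j v - q powi (- int d) *s v \<in> eig j k (- 1)"
    using raise_eig[OF assms] by simp
  then have "x l j v - q powi (- int d) *s v = 0"
    by (rule eig_outside[OF weyl_triple_standard(2)[OF assms(1)], rotated]) simp
  then show ?thesis by (simp add: eig_def)
qed

lemma eig_d_imp_eig_0:
  assumes "weyl_triple l j k" "v \<in> eig l j (int d)"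
  shows "v \<in> eig j k 0"
proof -
  have "x j k v - q powi (int d) *s v \<in> eig l j (int d + 1)"
    using lower_eig[OF assms] by simp
  then have "x j k v - q powi (int d) *s v = 0"
    by (rule eig_outside[OF weyl_triple_standard(1)[OF assms(1)], rotated]) simp
  then show ?thesis by (simp add: eig_def)
qed

section \<open>Components of flag vectors\<close>

definition flag_vector :: "4 \<Rightarrow> 'v \<Rightarrow> bool" where
  "flag_vector i v \<longleftrightarrow> v \<noteq> 0 \<and> v \<in> eig i (i + 1) 0"

text \<open>
  Passing back and forth between top and bottom eigenvectors shows that component 0 of the flag
  \<open>[i]\<close> is the same for all decompositions \<open>[i,j]\<close>.
\<close>

lemma flag_vector_eig:
  assumes "flag_vector i v"
  shows "v \<in> eig i (i + 1) 0" "v \<in> eig i (i + 2) 0"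
    "v \<in> eig (i - 1) i (int d)" "v \<in> eig (i - 2) i (int d)"
proof -
  show 1: "v \<in> eig i (i + 1) 0" using assms by (simp add: flag_vector_def)
  show 2: "v \<in> eig (i - 1) i (int d)"
    by (rule eig_0_imp_eig_d[OF _ 1]) (simp add: weyl_triple_def)
  show "v \<in> eig i (i + 2) 0"
    by (rule eig_d_imp_eig_0[OF _ 2]) (simp add: weyl_triple_def)
  show "v \<in> eig (i - 2) i (int d)"
    by (rule eig_0_imp_eig_d[OF _ 1]) (simp add: weyl_triple_def)
qed

lemma flag_vector_weyl:
  assumes "weyl_triple j k l" "flag_vector j v"
  shows "v \<in> eig j k 0" "v \<in> eig l j (int d)"
proof -
  have "k = j + 1 \<or> k = j + 2"
    using assms(1) by (auto simp: weyl_triple_def algebra_simps)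
  then show "v \<in> eig j k 0" using flag_vector_eig[OF assms(2)] by auto
  have "j - l = 1 \<or> j - l = 2"
    using weyl_triple_rotate[OF weyl_triple_rotate[OF assms(1)]] by (auto simp: weyl_triple_def)
  then have "l = j - 1 \<or> l = j - 2" by (auto simp: algebra_simps)
  then show "v \<in> eig l j (int d)" using flag_vector_eig[OF assms(2)] by auto
qed

lemma int_shift_sum:
  fixes f :: "int \<Rightarrow> 'v"
  shows "(\<Sum>z\<in>{a..b}. f (z + 1)) = (\<Sum>z\<in>{a + 1..b + 1}. f z)"
  by (rule sum.reindex_bij_witness[of _ "\<lambda>z. z - 1" "\<lambda>z. z + 1"]) auto

text \<open>
  By the bidiagonal shape, the part of \<open>x j k v = q\<^sup>d v\<close> in the eigenspace number
  \<open>z - 1\<close> involves only \<open>u z\<close> and \<open>u (z - 1)\<close>, and it determines the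
  off-diagonal term of \<open>x j k (u z)\<close>.
\<close>

lemma raise_components:
  assumes "weyl_triple j k l" "flag_vector j v" "resolves k l v u"
  shows "x j k (u z) = q powi (2 * z - int d) *s u z
    + (q powi int d - q powi (2 * z - 2 - int d)) *s u (z - 1)"
proof -
  note st = weyl_triple_standard[OF assms(1)]
  have u: "u z \<in> eig k l z" for z using assms(3) by (simp add: resolves_def)
  define r where "r z = x j k (u z) - q powi (2 * z - int d) *s u z" for z
  have r: "r z \<in> eig k l (z - 1)" for z
    unfolding r_def by (rule raise_eig[OF assms(1) u])
  have out: "u z = 0" if "z \<notin> {0..int d}" for z
    using eig_outside[OF st(2) that u] .
  \<comment> \<open>the part of \<open>x j k v - q\<^sup>d v\<close> in the eigenspace number \<open>z\<close>; the index \<open>- 1\<close> is needed to reach \<open>r 0\<close>\<close>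
  define w where "w z = r (z + 1) - (q powi int d - q powi (2 * z - int d)) *s u z" for z
  have w: "w z \<in> eig k l z" for z
    unfolding w_def using r[of "z + 1"] u[of z] subspace_eig[OF st(2)]
    by (auto intro!: subspace_diff subspace_scale)
  have rout: "r z = 0" if "z \<notin> {0..int d}" for z
    unfolding r_def out[OF that] by (simp add: x_zero[OF st(1)])
  have "(\<Sum>z\<in>{- 1..int d}. w z) = (\<Sum>z\<in>{0..int d + 1}. r z)
      - (\<Sum>z\<in>{- 1..int d}. (q powi int d - q powi (2 * z - int d)) *s u z)"
    using int_shift_sum[of r "- 1" "int d"] by (simp add: w_def sum_subtractf)
  also have "(\<Sum>z\<in>{0..int d + 1}. r z) = (\<Sum>z\<in>{0..int d}. r z)"
    by (rule sum.mono_neutral_right) (use rout in auto)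
  also have "(\<Sum>z\<in>{- 1..int d}. (q powi int d - q powi (2 * z - int d)) *s u z)
      = (\<Sum>z\<in>{0..int d}. (q powi int d - q powi (2 * z - int d)) *s u z)"
    by (rule sum.mono_neutral_right) (use out in auto)
  also have "(\<Sum>z\<in>{0..int d}. r z)
      - (\<Sum>z\<in>{0..int d}. (q powi int d - q powi (2 * z - int d)) *s u z)
      = x j k v - q powi int d *s v"
    using assms(3) st
    by (simp add: r_def resolves_def x_sum sum_subtractf scale_left_diff_distrib scale_sum_right)
  also have "\<dots> = 0"
    using eigD[OF flag_vector_weyl(1)[OF assms(1,2)]] by simp
  finally have sum0: "(\<Sum>z\<in>{- 1..int d}. w z) = 0" .
  have "w z = 0" for z
  proof (cases "z \<in> {- 1..int d}")
    case True
    show ?thesis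
      by (rule eig_sum_zero[OF st(2) _ w sum0 True]) simp
  next
    case False
    then show ?thesis using w[of z] by (intro eig_outside[OF st(2)]) auto
  qed
  from this[of "z - 1"] have "r z = (q powi int d - q powi (2 * (z - 1) - int d)) *s u (z - 1)"
    by (simp add: w_def)
  then have "x j k (u z) = q powi (2 * z - int d) *s u z
    + (q powi int d - q powi (2 * (z - 1) - int d)) *s u (z - 1)"
    by (simp add: r_def diff_eq_eq add.commute)
  moreover have "2 * (z - 1) - int d = 2 * z - 2 - int d" by simp
  ultimately show ?thesis by simp
qed

text \<open>
  The same comparison for \<open>x l j v = q\<^sup>-\<^sup>d v\<close>.
\<close>

lemma lower_components:
  assumes "weyl_triple j k l" "flag_vector j v" "resolves k l v u"
  shows "x l j (u z) = q powi (2 * z - int d) *s u z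
    + (q powi (- int d) - q powi (2 * z + 2 - int d)) *s u (z + 1)"
proof -
  note st = weyl_triple_standard[OF assms(1)]
  note rot = weyl_triple_rotate[OF assms(1)]
  have u: "u z \<in> eig k l z" for z using assms(3) by (simp add: resolves_def)
  define r where "r z = x l j (u z) - q powi (2 * z - int d) *s u z" for z
  have r: "r z \<in> eig k l (z + 1)" for z
    unfolding r_def by (rule lower_eig[OF rot u])
  have out: "u z = 0" if "z \<notin> {0..int d}" for z
    using eig_outside[OF st(2) that u] .
  \<comment> \<open>the part of \<open>x l j v - q\<^sup>-\<^sup>d v\<close> in the eigenspace number \<open>z + 1\<close>\<close>
  define w where "w z = r z - (q powi (- int d) - q powi (2 * (z + 1) - int d)) *s u (z + 1)" for z
  have w: "w z \<in> eig k l (z + 1)" for z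
    unfolding w_def using r[of z] u[of "z + 1"] subspace_eig[OF st(2)]
    by (auto intro!: subspace_diff subspace_scale)
  have rout: "r z = 0" if "z \<notin> {0..int d}" for z
    unfolding r_def out[OF that] by (simp add: x_zero[OF st(3)])
  have "(\<Sum>z\<in>{- 1..int d}. w z) = (\<Sum>z\<in>{- 1..int d}. r z)
      - (\<Sum>z\<in>{0..int d + 1}. (q powi (- int d) - q powi (2 * z - int d)) *s u z)"
    using int_shift_sum[of "\<lambda>z. (q powi (- int d) - q powi (2 * z - int d)) *s u z" "- 1" "int d"]
    by (simp add: w_def sum_subtractf)
  also have "(\<Sum>z\<in>{- 1..int d}. r z) = (\<Sum>z\<in>{0..int d}. r z)"
    by (rule sum.mono_neutral_right) (use rout in auto)
  also have "(\<Sum>z\<in>{0..int d + 1}. (q powi (- int d) - q powi (2 * z - int d)) *s u z)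
      = (\<Sum>z\<in>{0..int d}. (q powi (- int d) - q powi (2 * z - int d)) *s u z)"
    by (rule sum.mono_neutral_right) (use out in auto)
  also have "(\<Sum>z\<in>{0..int d}. r z)
      - (\<Sum>z\<in>{0..int d}. (q powi (- int d) - q powi (2 * z - int d)) *s u z)
      = x l j v - q powi (- int d) *s v"
    using assms(3) st
    by (simp add: r_def resolves_def x_sum sum_subtractf scale_left_diff_distrib scale_sum_right)
  also have "\<dots> = 0"
    using eigD[OF flag_vector_weyl(2)[OF assms(1,2)]] by simp
  finally have sum0: "(\<Sum>z\<in>{0..int d + 1}. w (z - 1)) = 0"
    using int_shift_sum[of "\<lambda>z. w (z - 1)" "- 1" "int d"] by simp
  have w': "w (z - 1) \<in> eig k l z" for z using w[of "z - 1"] by simp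
  have "w (z - 1) = 0" for z
  proof (cases "z \<in> {0..int d + 1}")
    case True
    show ?thesis
      by (rule eig_sum_zero[OF st(2) _ w' sum0 True]) simp
  next
    case False
    then show ?thesis using w'[of z] by (intro eig_outside[OF st(2)]) auto
  qed
  from this[of "z + 1"] have "r z = (q powi (- int d) - q powi (2 * (z + 1) - int d)) *s u (z + 1)"
    by (simp add: w_def)
  then have "x l j (u z) = q powi (2 * z - int d) *s u z
    + (q powi (- int d) - q powi (2 * (z + 1) - int d)) *s u (z + 1)"
    by (simp add: r_def diff_eq_eq add.commute)
  moreover have "2 * (z + 1) - int d = 2 * z + 2 - int d" by simp
  ultimately show ?thesis by simp
qed

text \<open>
  The coefficients in the two preceding lemmas are nonzero inside \<open>0..d\<close>, so one vanishing
  component would force its neighbours, and in the end all of \<open>v\<close>, to vanish.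
\<close>

lemma components_nonzero:
  assumes "weyl_triple j k l" "flag_vector j v" "resolves k l v u" "z \<in> {0..int d}"
  shows "u z \<noteq> 0"
proof
  assume z0: "u z = 0"
  note st = weyl_triple_standard[OF assms(1)]
  have down: "u (y - 1) = 0" if "u y = 0" "y \<le> int d" for y
  proof -
    have "(q powi int d - q powi (2 * y - 2 - int d)) *s u (y - 1) = 0"
      using raise_components[OF assms(1-3), of y] that x_zero[OF st(1)] by simp
    then show ?thesis using that(2) by (auto simp: q_powi_inject simp del: power_int_of_nat)
  qed
  have up: "u (y + 1) = 0" if "u y = 0" "0 \<le> y" for y
  proof -
    have "(q powi (- int d) - q powi (2 * y + 2 - int d)) *s u (y + 1) = 0"
      using lower_components[OF assms(1-3), of y] that x_zero[OF st(3)] by simp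
    then show ?thesis using that(2) by (auto simp: q_powi_inject simp del: power_int_of_nat)
  qed
  have "u y = 0" if "y \<in> {0..int d}" for y
  proof (cases "y \<le> z")
    case True
    then show ?thesis using assms(4)
    proof (induction rule: int_le_induct)
      case base
      then show ?case using z0 by simp
    next
      case (step i)
      then show ?case using down[of i] by simp
    qed
  next
    case False
    then have "z \<le> y" by simp
    then show ?thesis using assms(4)
    proof (induction rule: int_ge_induct)
      case base
      then show ?case using z0 by simp
    next
      case (step i)
      then show ?case using up[of i] by simp
    qed
  qed
  then have "v = 0" using assms(3) by (simp add: resolves_def)
  then show False using assms(2) by (simp add: flag_vector_def)
qed

section \<open>The evaluation relations and the ratios of components\<close>

text \<open>
  Unlike the defining relations of the algebra, this one depends on the evaluation parameter.
\<close>

definition evaluation_relation :: "4 \<Rightarrow> 'f \<Rightarrow> bool" where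
  "evaluation_relation r s \<longleftrightarrow> (\<forall>v.
     ((q - inverse q) * s) *s (x r (r + 1) v - x (r + 2) (r + 3) v)
     = x (r + 3) r (x (r + 1) (r + 2) v) - x (r + 1) (r + 2) (x (r + 3) r v))"

lemma evaluation_relation_shift:
  assumes "evaluation_relation r s"
  shows "evaluation_relation (r + 2) s"
  unfolding evaluation_relation_def
proof
  fix v
  have "- (((q - inverse q) * s) *s (x r (r + 1) v - x (r + 2) (r + 3) v))
      = - (x (r + 3) r (x (r + 1) (r + 2) v) - x (r + 1) (r + 2) (x (r + 3) r v))"
    using assms unfolding evaluation_relation_def by metis
  then show "((q - inverse q) * s) *s (x (r + 2) (r + 2 + 1) v - x (r + 2 + 2) (r + 2 + 3) v)
      = x (r + 2 + 3) (r + 2) (x (r + 2 + 1) (r + 2 + 2) v)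
        - x (r + 2 + 1) (r + 2 + 2) (x (r + 2 + 3) (r + 2) v)"
    by (simp add: add.assoc z4_wrap flip: scale_minus_right)
qed

lemma eig_coefficients_zero:
  assumes "standard_pair k l" and u: "\<And>z. z \<in> {0..int d} \<Longrightarrow> u z \<in> eig k l z"
    and "\<And>z. z \<in> {0..int d} \<Longrightarrow> u z \<noteq> 0"
    and "(\<Sum>z\<in>{0..int d}. g z *s u z) = 0" and z: "z \<in> {0..int d}"
  shows "g z = 0"
proof -
  have "g z *s u z = 0"
    by (rule eig_sum_zero[OF assms(1) _ _ assms(4) z])
      (use u subspace_scale[OF subspace_eig[OF assms(1)]] in auto)
  then show ?thesis using assms(3) z by simp
qed

text \<open>
  Write \<open>A\<close>, \<open>K\<close>, \<open>E\<close> for \<open>x (r + 3) r\<close>,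
  \<open>x (r + 2) (r + 3)\<close>, \<open>x (r + 1) (r + 2)\<close>, and put \<open>y = K v - q\<^sup>d v\<close>. Since
  \<open>A v = q\<^sup>-\<^sup>d v\<close>, the evaluation relation expresses \<open>(A - q\<^sup>-\<^sup>d) E v\<close> by
  \<open>y\<close>, which is itself an eigenvector of \<open>A\<close> because of a Weyl relation. Hence a
  combination of \<open>E v\<close> and \<open>y\<close> lies in the one-dimensional eigenspace of \<open>A\<close>
  spanned by \<open>v\<close>. In components this is a recurrence for \<open>a\<close> with one unknown factor
  \<open>\<mu>\<close>, and its last equation, where the recurrence stops, yields \<open>\<mu>\<close>.
\<close>

lemma adjacent_flag_ratio:
  assumes R: "evaluation_relation r s"
    and v: "flag_vector r v" and v': "flag_vector (r + 1) v'"
    and u: "resolves (r + 2) (r + 3) v' u"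
    and a: "resolves (r + 2) (r + 3) v (\<lambda>z. a z *s u z)"
    and z: "0 \<le> z" "z < int d"
  shows "a (z + 1) = (1 - s * q powi (int d - 2 * z - 1)) * a z"
proof -
  have T1: "weyl_triple r (r + 2) (r + 3)" and T2: "weyl_triple (r + 1) (r + 2) (r + 3)"
    by (simp_all add: weyl_triple_def)
  note T3 = weyl_triple_rotate[OF T1]
  note st = weyl_triple_standard[OF T1] weyl_triple_standard[OF T2]
  have uz: "u z \<in> eig (r + 2) (r + 3) z" for z using u by (simp add: resolves_def)
  have u_out: "u z = 0" if "z \<notin> {0..int d}" for z
    using eig_outside[OF st(2) that uz] .
  have u0: "u z \<noteq> 0" if "z \<in> {0..int d}" for z
    by (rule components_nonzero[OF T2 v' u that])
  have a0: "a z \<noteq> 0" if "z \<in> {0..int d}" for z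
    using components_nonzero[OF T1 v a that] by auto
  let ?A = "x (r + 3) r" and ?K = "x (r + 2) (r + 3)" and ?E = "x (r + 1) (r + 2)"
  \<comment> \<open>chosen so that the two multiples of \<open>y\<close> in \<open>?A (?E v + \<sigma> *s y)\<close> combine to \<open>q\<^sup>-\<^sup>d \<sigma> y\<close>\<close>
  define \<sigma> where "\<sigma> = s * q powi (int d - 1)"
  define y where "y = ?K v - q powi int d *s v"
  have "v \<in> eig (r + 3) r (int d)" by (rule flag_vector_weyl(2)[OF T1 v])
  then have Av: "?A v = q powi (- int d) *s v" and "y \<in> eig (r + 3) r (int d - 1)"
    using raise_eig[OF T3, of v "int d"] by (simp_all add: eig_def y_def)
  then have Ay: "?A y = q powi (2 - int d) *s y" by (simp add: eig_def)
  have "((q - inverse q) * s) *s (q powi int d *s v - ?K v)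
      = ?A (?E v) - ?E (?A v)"
    using R eigD[OF flag_vector_eig(1)[OF v]] unfolding evaluation_relation_def
    by (metis diff_zero mult_zero_right)
  then have "?A (?E v) = q powi (- int d) *s ?E v - ((q - inverse q) * s) *s y"
    using st by (simp add: Av x_scale y_def algebra_simps)
  then have "?A (?E v + \<sigma> *s y)
      = q powi (- int d) *s ?E v + (\<sigma> * q powi (2 - int d) - (q - inverse q) * s) *s y"
    using st by (simp add: x_add x_scale Ay scale_left_diff_distrib)
  also have "\<sigma> * q powi (2 - int d) - (q - inverse q) * s = q powi (- int d) * \<sigma>"
    using q_nonzero by (simp add: \<sigma>_def q_powi_expand field_simps power2_eq_square)
  finally have "?E v + \<sigma> *s y \<in> eig (r + 3) r (int d)"
    by (simp add: eig_def scale_right_distrib)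
  then obtain \<mu> where \<mu>: "?E v + \<sigma> *s y = \<mu> *s v"
    using eig_proportional[OF st(3) \<open>v \<in> eig (r + 3) r (int d)\<close>] v
    by (auto simp: flag_vector_def)
  define f where "f z = q powi int d - q powi (2 * z - int d)" for z
  have Eu: "?E (u z) = q powi (2 * z - int d) *s u z + f (z - 1) *s u (z - 1)" for z
  proof -
    have "2 * z - 2 - int d = 2 * (z - 1) - int d" by simp
    then show ?thesis using raise_components[OF T2 v' u, of z] by (simp only: f_def)
  qed
  have "?E v = (\<Sum>z\<in>{0..int d}. a z *s ?E (u z))"
    using a st by (simp add: resolves_def x_sum x_scale)
  also have "\<dots> = (\<Sum>z\<in>{0..int d}. (a z * q powi (2 * z - int d)) *s u z)
      + (\<Sum>z\<in>{0..int d}. (a z * f (z - 1)) *s u (z - 1))"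
    by (simp add: Eu scale_right_distrib sum.distrib)
  also have "(\<Sum>z\<in>{0..int d}. (a z * f (z - 1)) *s u (z - 1))
      = (\<Sum>z\<in>{- 1..int d - 1}. (a (z + 1) * f z) *s u z)"
    using int_shift_sum[of "\<lambda>z. (a z * f (z - 1)) *s u (z - 1)" "- 1" "int d - 1"] by simp
  also have "\<dots> = (\<Sum>z\<in>{- 1..int d}. (a (z + 1) * f z) *s u z)"
    by (rule sum.mono_neutral_left) (auto simp: f_def not_le)
  also have "\<dots> = (\<Sum>z\<in>{0..int d}. (a (z + 1) * f z) *s u z)"
    by (rule sum.mono_neutral_right) (use u_out in auto)
  finally have Ev: "?E v = (\<Sum>z\<in>{0..int d}. (a z * q powi (2 * z - int d)) *s u z)
      + (\<Sum>z\<in>{0..int d}. (a (z + 1) * f z) *s u z)" .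
  have Kv: "?K v = (\<Sum>z\<in>{0..int d}. (a z * q powi (int d - 2 * z)) *s u z)"
    using a st eigD[OF uz] by (simp add: resolves_def x_sum x_scale)
  have sv: "c *s v = (\<Sum>z\<in>{0..int d}. (c * a z) *s u z)" for c
    using a by (simp add: resolves_def scale_sum_right)
  \<comment> \<open>coefficient of \<open>u z\<close> in \<open>?E v + \<sigma> *s y - \<mu> *s v\<close>\<close>
  define g where "g z = a z * q powi (2 * z - int d) + a (z + 1) * f z
    + \<sigma> * (a z * q powi (int d - 2 * z) - q powi int d * a z) - \<mu> * a z" for z
  have "(\<Sum>z\<in>{0..int d}. g z *s u z) = ?E v + \<sigma> *s y - \<mu> *s v"
    unfolding y_def Ev Kv sv g_def scale_left_distrib scale_left_diff_distrib sum.distrib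
      sum_subtractf scale_right_diff_distrib scale_sum_right
    by (simp add: right_diff_distrib scale_left_diff_distrib sum_subtractf)
  then have g0: "g z = 0" if "z \<in> {0..int d}" for z
    using eig_coefficients_zero[OF st(2) uz u0 _ that] \<mu> by simp
  have fz: "f z \<noteq> 0" using z by (simp add: f_def q_powi_inject del: power_int_of_nat)
  \<comment> \<open>the term with \<open>a (int d + 1)\<close> drops out because \<open>f (int d) = 0\<close>\<close>
  have "(q powi int d + \<sigma> * (q powi (- int d) - q powi int d) - \<mu>) * a (int d) = 0"
    using g0[of "int d"] by (simp add: g_def f_def algebra_simps)
  then have \<mu>_eq: "\<mu> = q powi int d + \<sigma> * (q powi (- int d) - q powi int d)"
    using a0[of "int d"] by simp
  have "g z = a (z + 1) * f z
      - a z * (f z + \<sigma> * (q powi (- int d) - q powi (int d - 2 * z)))"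
    unfolding g_def \<mu>_eq by (simp add: f_def algebra_simps)
  then have "a (z + 1) * f z
      = a z * (f z + \<sigma> * (q powi (- int d) - q powi (int d - 2 * z)))"
    using g0[of z] z by simp
  also have "f z + \<sigma> * (q powi (- int d) - q powi (int d - 2 * z))
      = (1 - s * q powi (int d - 2 * z - 1)) * f z"
    using q_nonzero
    by (simp add: \<sigma>_def f_def q_powi_expand field_simps power2_eq_square)
  finally show ?thesis using fz by simp
qed

lemma eig_inverse:
  assumes "l - k = 2"
  shows "eig k l z = eig l k (int d - z)"
proof -
  have sub: "eig k l z \<subseteq> eig l k (int d - z)" if kl: "l - k = 2" for k l z
  proof
    fix v assume v: "v \<in> eig k l z"
    have "k - l = - (l - k)" by simp
    then have lk: "k - l = 2" unfolding kl by simp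
    have "v = x l k (q powi (int d - 2 * z) *s v)"
      using x_inverse[of k l v] lk eigD[OF v] by simp
    also have "\<dots> = q powi (int d - 2 * z) *s x l k v"
      using lk by (simp add: x_scale standard_pair_def)
    finally have "q powi (2 * z - int d) *s v = (q powi (2 * z - int d) * q powi (int d - 2 * z)) *s x l k v"
      by (metis scale_scale)
    also have "q powi (2 * z - int d) * q powi (int d - 2 * z) = 1"
      using q_nonzero by (simp flip: power_int_add)
    finally show "v \<in> eig l k (int d - z)"
      by (simp add: eig_def algebra_simps)
  qed
  have "k - l = - (l - k)" by simp
  then have "k - l = 2" unfolding assms by simp
  then show ?thesis using sub[OF assms, of z] sub[of k l "int d - z"] by auto
qed

lemma resolves_inverse:
  assumes "l - k = 2" "resolves k l v u"
  shows "resolves l k v (\<lambda>z. u (int d - z))"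
proof -
  have "u (int d - z) \<in> eig l k z" for z
    using assms eig_inverse[OF assms(1), of "int d - z"] by (auto simp: resolves_def)
  moreover have "(\<Sum>z\<in>{0..int d}. u z) = (\<Sum>z\<in>{0..int d}. u (int d - z))"
    by (rule sum.reindex_bij_witness[of _ "\<lambda>z. int d - z" "\<lambda>z. int d - z"]) auto
  ultimately show ?thesis using assms(2) by (simp add: resolves_def)
qed

text \<open>
  Apply the evaluation relation to component \<open>z + 1\<close> of \<open>v\<close> and compare the parts in
  the eigenspace number \<open>z\<close>. Only \<open>x r (r + 1)\<close> and \<open>x (r + 1) (r + 2)\<close> decrease
  the index. The first acts on the components of \<open>v\<close> by \<open>raise_components\<close>, the second
  on the components of \<open>v'\<close> by \<open>lower_components\<close> for the inverted decomposition
  \<open>[r+3,r+1]\<close>; equating the two gives the factor between the components of \<open>v\<close> and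
  \<open>v'\<close>.
\<close>

lemma opposite_flag_ratio:
  assumes R: "evaluation_relation (r + 1) (inverse s)" and s: "s \<noteq> 0"
    and v: "flag_vector r v" and v': "flag_vector (r + 2) v'"
    and u: "resolves (r + 1) (r + 3) v' u"
    and a: "resolves (r + 1) (r + 3) v (\<lambda>z. a z *s u z)"
    and z: "0 \<le> z" "z < int d"
  shows "a (z + 1) = s * q powi (int d - 1) * a z"
proof -
  have T1: "weyl_triple r (r + 1) (r + 3)" and T2: "weyl_triple (r + 2) (r + 3) (r + 1)"
    by (simp_all add: weyl_triple_def)
  note st = weyl_triple_standard[OF T1] weyl_triple_standard[OF T2]
  note sub = subspace_eig[OF st(2)]
  let ?e = "eig (r + 1) (r + 3)"
  have inv: "eig (r + 3) (r + 1) y = ?e (int d - y)" for y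
    by (rule eig_inverse) simp
  have uz: "u z \<in> ?e z" for z using u by (simp add: resolves_def)
  have u0: "u z \<noteq> 0"
    using components_nonzero[OF T2 v' resolves_inverse[OF _ u], of "int d - z"] z by simp
  let ?P = "a z *s u z" and ?Q = "a (z + 1) *s u (z + 1)"
  define \<beta> where "\<beta> = q powi int d - q powi (2 * z - int d)"
  define \<gamma> where "\<gamma> = q powi (- int d) - q powi (int d - 2 * z)"
  define \<kappa> where "\<kappa> = (q - inverse q) * inverse s"
  define h where "h = q powi (2 * z + 2 - int d)"
  define h' where "h' = q powi (int d - 2 * z - 2)"
  have Q: "?Q \<in> ?e (z + 1)" by (rule subspace_scale[OF sub uz])
  have ab: "x r (r + 1) ?Q = h *s ?Q + \<beta> *s ?P"
    using raise_components[OF T1 v a, of "z + 1"] by (simp add: h_def \<beta>_def algebra_simps)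
  have bc: "x (r + 1) (r + 2) ?Q = h' *s ?Q + (\<gamma> * a (z + 1)) *s u z"
  proof -
    have "x (r + 1) (r + 2) (u (z + 1)) = h' *s u (z + 1) + \<gamma> *s u z"
      using lower_components[OF T2 v' resolves_inverse[OF _ u], of "int d - z - 1"]
      by (simp add: h'_def \<gamma>_def algebra_simps)
    then show ?thesis using st
      by (simp add: x_scale scale_right_distrib mult.commute)
  qed
  have ce: "x (r + 2) (r + 3) w - q powi (int d - 2 * y) *s w \<in> ?e (y + 1)"
    if "w \<in> ?e y" for w y
    using raise_eig[OF T2, of w "int d - y"] that unfolding inv
    by (simp add: algebra_simps)
  obtain z1 where z1: "z1 \<in> ?e (z + 2)" "x (r + 2) (r + 3) ?Q = h' *s ?Q + z1"
  proof
    show "x (r + 2) (r + 3) ?Q - h' *s ?Q \<in> ?e (z + 2)"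
      using ce[OF Q] by (simp add: h'_def algebra_simps)
  qed simp
  obtain z0 where z0: "z0 \<in> ?e (z + 1)" "x (r + 2) (r + 3) ?P = (q\<^sup>2 * h') *s ?P + z0"
  proof
    have "q\<^sup>2 * h' = q powi (int d - 2 * z)"
      using q_nonzero by (simp add: h'_def q_powi_expand field_simps)
    then show "x (r + 2) (r + 3) ?P - (q\<^sup>2 * h') *s ?P \<in> ?e (z + 1)"
      using ce[OF subspace_scale[OF sub uz]] by simp
  qed simp
  obtain z2 where z2: "z2 \<in> ?e (z + 1)" "x r (r + 1) z1 = (q\<^sup>2 * h) *s z1 + z2"
  proof
    have "q\<^sup>2 * h = q powi (2 * (z + 2) - int d)"
      using q_nonzero by (simp add: h_def q_powi_expand field_simps)
    then show "x r (r + 1) z1 - (q\<^sup>2 * h) *s z1 \<in> ?e (z + 1)"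
      using raise_eig[OF T1 z1(1)] by (simp add: add.commute[of 1 z])
  qed simp
  obtain z3 where z3: "z3 \<in> ?e (z + 2)" "x (r + 3) r ?Q = h *s ?Q + z3"
  proof
    show "x (r + 3) r ?Q - h *s ?Q \<in> ?e (z + 2)"
      using lower_eig[OF weyl_triple_rotate[OF T1] Q] by (simp add: h_def algebra_simps)
  qed simp
  have R': "\<kappa> *s (x (r + 1) (r + 2) ?Q - x (r + 3) r ?Q)
      = x r (r + 1) (x (r + 2) (r + 3) ?Q) - x (r + 2) (r + 3) (x r (r + 1) ?Q)"
    using R unfolding evaluation_relation_def \<kappa>_def by (simp add: add.assoc z4_wrap)
  \<comment> \<open>the parts of the relation in the eigenspaces number \<open>z\<close>, \<open>z + 1\<close> and \<open>z + 2\<close>\<close>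
  define X where "X = (\<kappa> * \<gamma> * a (z + 1) - \<beta> * (h' - q\<^sup>2 * h') * a z) *s u z"
  define Y where "Y = (\<kappa> * (h' - h)) *s ?Q - z2 + \<beta> *s z0"
  define W where "W = - (\<kappa> *s z3) - (q\<^sup>2 * h - h) *s z1"
  have "x r (r + 1) (x (r + 2) (r + 3) ?Q)
      = h' *s (h *s ?Q + \<beta> *s ?P) + ((q\<^sup>2 * h) *s z1 + z2)"
    using st unfolding z1(2) by (simp add: x_add x_scale[of r "r + 1" h'] ab z2(2) del: scale_scale)
  moreover have "x (r + 2) (r + 3) (x r (r + 1) ?Q)
      = h *s (h' *s ?Q + z1) + \<beta> *s ((q\<^sup>2 * h') *s ?P + z0)"
    using st unfolding ab by (simp add: x_add x_scale[of "r + 2" "r + 3" h] x_scale[of "r + 2" "r + 3" \<beta>] z1(2) z0(2) del: scale_scale)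
  ultimately have sum0: "X + Y + W = 0"
    using R' unfolding bc z3(2) X_def Y_def W_def by (simp add: algebra_simps)
  define w where "w y = (if y = z then X else if y = z + 1 then Y else W)" for y
  have "w z = 0"
  proof (rule eig_sum_zero[OF st(2)])
    show "finite {z, z + 1, z + 2}" "z \<in> {z, z + 1, z + 2}" by simp_all
    show "(\<Sum>y\<in>{z, z + 1, z + 2}. w y) = 0"
      using sum0 by (simp add: w_def add.assoc)
    have "X \<in> ?e z" unfolding X_def by (rule subspace_scale[OF sub uz])
    moreover have "Y \<in> ?e (z + 1)" unfolding Y_def
      by (intro subspace_add[OF sub] subspace_diff[OF sub] subspace_scale[OF sub] uz z2(1) z0(1))
    moreover have "W \<in> ?e (z + 2)" unfolding W_def
      by (intro subspace_neg[OF sub] subspace_diff[OF sub] subspace_scale[OF sub] z3(1) z1(1))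
    ultimately show "w y \<in> ?e y" if "y \<in> {z, z + 1, z + 2}" for y
      using that by (auto simp: w_def)
  qed
  then have "\<kappa> * \<gamma> * a (z + 1) = \<beta> * (h' - q\<^sup>2 * h') * a z"
    using u0 by (simp add: w_def X_def)
  also have "\<beta> * (h' - q\<^sup>2 * h') = \<kappa> * \<gamma> * (s * q powi (int d - 1))"
    using q_nonzero s
    by (simp add: \<beta>_def h'_def \<kappa>_def \<gamma>_def q_powi_expand field_simps power2_eq_square)
  finally have "\<kappa> * \<gamma> * a (z + 1) = \<kappa> * \<gamma> * (s * q powi (int d - 1) * a z)"
    by (simp add: mult.assoc)
  moreover have "\<gamma> \<noteq> 0" using z by (simp add: \<gamma>_def q_powi_inject del: power_int_of_nat)
  moreover have "\<kappa> \<noteq> 0" using s q_minus_inverse_nonzero by (simp add: \<kappa>_def)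
  ultimately show ?thesis by simp
qed

end

section \<open>The evaluation relations from the defining matrices\<close>

lemma mult_mat_index_sum:
  assumes "A \<in> carrier_mat n n" "B \<in> carrier_mat n n" "i < n" "j < n"
  shows "(A * B) $$ (i, j) = (\<Sum>k\<in>{0..<n}. A $$ (i, k) * B $$ (k, j))"
proof -
  note dims = carrier_matD[OF assms(1)] carrier_matD[OF assms(2)]
  have "(A * B) $$ (i, j) = row A i \<bullet> col B j"
    using assms(3,4) dims by (intro index_mult_mat(1)) simp_all
  then show ?thesis
    using assms(3,4) dims by (simp add: scalar_prod_def)
qed

text \<open>
  Conjugation by \<open>Z\<close> reverses the order of the basis.
\<close>

lemma Z_mat_conjugate_index:
  fixes M :: "'a::field mat"
  assumes M: "M \<in> carrier_mat (d + 1) (d + 1)" and ij: "i \<le> d" "j \<le> d"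
  shows "(Z_mat d * M * Z_mat d) $$ (i, j) = M $$ (d - i, d - j)"
proof -
  have Z: "Z_mat d \<in> carrier_mat (d + 1) (d + 1)" by (simp add: Z_mat_def)
  have entry: "Z_mat d $$ (a, b) = (if b = d - a then 1 else 0)" "Z_mat d $$ (b, a) = (if b = d - a then 1 else 0)"
    if "a \<le> d" "b \<le> d" for a b
    using that by (auto simp: Z_mat_def)
  have ZM: "(Z_mat d * M) $$ (a, b) = M $$ (d - a, b)" if "a \<le> d" "b \<le> d" for a b
  proof -
    have "(Z_mat d * M) $$ (a, b) = (\<Sum>k\<in>{0..<d + 1}. Z_mat d $$ (a, k) * M $$ (k, b))"
      using that by (intro mult_mat_index_sum[OF Z M]) simp_all
    also have "\<dots> = (\<Sum>k\<in>{0..<d + 1}. if k = d - a then M $$ (d - a, b) else 0)"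
      using that by (intro sum.cong) (auto simp: entry)
    finally show ?thesis by (simp del: sum.op_ivl_Suc)
  qed
  have "(Z_mat d * M * Z_mat d) $$ (i, j)
      = (\<Sum>k\<in>{0..<d + 1}. (Z_mat d * M) $$ (i, k) * Z_mat d $$ (k, j))"
    using ij by (intro mult_mat_index_sum[OF mult_carrier_mat[OF Z M] Z]) simp_all
  also have "\<dots> = (\<Sum>k\<in>{0..<d + 1}. if k = d - j then M $$ (d - i, d - j) else 0)"
    using ij by (intro sum.cong) (auto simp: entry ZM)
  finally show ?thesis by (simp del: sum.op_ivl_Suc)
qed

context generic_evaluation_module begin

text \<open>
  The basis is continued by 0 on both sides so that one formula covers all integers. The conditions
  on \<open>\<beta>\<close> and \<open>\<gamma>\<close> make the formula give 0 just beyond the two ends of the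
  basis, where a neighbouring basis vector is nonzero.
\<close>

lemma tridiagonal_action:
  assumes rep: "represents scale vs M A" and len: "length vs = d + 1" and A0: "A 0 = 0"
    and M: "\<And>i n. i \<le> d \<Longrightarrow> n \<le> d \<Longrightarrow> M $$ (i, n) =
      (if i = n then \<alpha> (int n) else if n = i + 1 then \<beta> (int n)
       else if i = n + 1 then \<gamma> (int n) else 0)"
    and ends: "\<beta> (int d + 1) = 0" "\<gamma> (- 1) = 0"
    and u: "u = (\<lambda>z. if z \<in> {0..int d} then vs ! nat z else 0)"
  shows "A (u z) = \<alpha> z *s u z + \<beta> z *s u (z - 1) + \<gamma> z *s u (z + 1)"
proof (cases "z \<in> {0..int d}")
  case True
  then obtain n where z: "z = int n" and n: "n \<le> d"
    by (metis atLeastAtMost_iff of_nat_le_iff zero_le_imp_eq_int)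
  have "A (u z) = (\<Sum>i<d + 1. M $$ (i, n) *s vs ! i)"
    using rep len n by (simp add: represents_def u z del: sum.lessThan_Suc)
  also have "\<dots> = (\<Sum>i<d + 1. (if i = n then \<alpha> z *s u z else 0)
      + (if n = i + 1 then \<beta> z *s u (z - 1) else 0)
      + (if i = n + 1 then \<gamma> z *s u (z + 1) else 0))"
    using n by (intro sum.cong) (auto simp: M u z nat_add_distrib)
  also have "\<dots> = \<alpha> z *s u z + (\<Sum>i<d + 1. if n = i + 1 then \<beta> z *s u (z - 1) else 0)
      + \<gamma> z *s u (z + 1)"
    using n by (simp add: sum.distrib u z del: sum.lessThan_Suc)
  also have "(\<Sum>i<d + 1. if n = i + 1 then \<beta> z *s u (z - 1) else 0) = \<beta> z *s u (z - 1)"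
    using n by (cases n) (simp_all add: u z del: sum.lessThan_Suc)
  finally show ?thesis .
next
  case False
  then have "z = - 1 \<or> z = int d + 1 \<or> z - 1 \<notin> {0..int d} \<and> z + 1 \<notin> {0..int d}" by auto
  then show ?thesis
    using False A0 ends by (auto simp: u)
qed

lemma evaluation_relation_on_basis:
  assumes B: "span B = UNIV" and rel: "\<And>v. v \<in> B \<Longrightarrow>
     ((q - inverse q) * s) *s (x r (r + 1) v - x (r + 2) (r + 3) v)
     = x (r + 3) r (x (r + 1) (r + 2) v) - x (r + 1) (r + 2) (x (r + 3) r v)"
  shows "evaluation_relation r s"
proof -
  have st: "standard_pair r (r + 1)" "standard_pair (r + 2) (r + 3)"
    "standard_pair (r + 3) r" "standard_pair (r + 1) (r + 2)"
    by (simp_all add: standard_pair_def)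
  define L where "L v = ((q - inverse q) * s) *s (x r (r + 1) v - x (r + 2) (r + 3) v)
     - (x (r + 3) r (x (r + 1) (r + 2) v) - x (r + 1) (r + 2) (x (r + 3) r v))" for v
  have add: "L (v + w) = L v + L w" for v w
    unfolding L_def x_add[OF st(1)] x_add[OF st(2)] x_add[OF st(3)] x_add[OF st(4)]
    by (simp only: scale_right_diff_distrib scale_right_distrib) (simp add: algebra_simps)
  have scale: "L (c *s v) = c *s L v" for c v
    unfolding L_def x_scale[OF st(1)] x_scale[OF st(2)] x_scale[OF st(3)] x_scale[OF st(4)]
    by (simp add: scale_right_diff_distrib mult.commute mult.left_commute)
  have "L v = 0" for v
  proof -
    have "v \<in> span B" using B by simp
    then show ?thesis
    proof (induction rule: span_induct_alt)
      case base
      then show ?case using scale[of 0 0] by simp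
    next
      case (step c b y)
      then show ?case using rel[of b] by (simp add: add scale L_def[of b])
    qed
  qed
  then show ?thesis unfolding evaluation_relation_def L_def by simp
qed

text \<open>
  In the basis that defines the parameter, \<open>x 2 3\<close> is diagonal, \<open>x 1 2\<close> and
  \<open>x 3 0\<close> are bidiagonal and \<open>x 0 1\<close> is tridiagonal. Both sides of either relation are
  therefore tridiagonal, and the relation amounts to an identity of rational functions for each
  of the diagonals.
\<close>

lemma evaluation_relations_of_parameter:
  assumes "evaluation_parameter scale q x d t"
  shows "evaluation_relation 0 t" and "evaluation_relation 1 (inverse t)"
proof -
  obtain vs where t: "t \<noteq> 0" and len: "length vs = d + 1" and basis: "is_basis scale vs"
    and x01: "represents scale vs (Z_mat d * S_mat d (inverse q) (inverse t) * Z_mat d) (x 0 1)"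
    and x12: "represents scale vs (E_mat d q) (x 1 2)"
    and x23: "represents scale vs (K_mat d q) (x 2 3)"
    and x30: "represents scale vs (Z_mat d * G_mat d (inverse q) t * Z_mat d) (x 3 0)"
    using assms unfolding evaluation_parameter_def by blast
  have st: "standard_pair 0 1" "standard_pair 1 2" "standard_pair 2 3" "standard_pair 3 0"
    by (simp_all add: standard_pair_def)
  have four: "(4 :: 4) = 0" by simp
  have inv: "inverse q powi e = q powi (- e)" "inverse q ^ d = q powi (- int d)" for e
    by (simp_all add: power_int_inverse power_int_minus power_inverse)
  define u where "u = (\<lambda>z. if z \<in> {0..int d} then vs ! nat z else 0)"
  \<comment> \<open>coefficients on the basis: the common diagonal of \<open>x 1 2\<close> and \<open>x 3 0\<close>, their off-diagonals, and the three diagonals of \<open>x 0 1\<close>\<close>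
  define \<theta> where "\<theta> z = q powi (2 * z - int d)" for z
  define e where "e z = q powi int d - q powi (2 * z - 2 - int d)" for z
  define g where "g z = (q powi (- int d) - q powi (2 * z + 2 - int d))
    * (1 - t * q powi (int d - 2 * z - 1))" for z
  define sd where "sd z = q powi (- int d)
    - (q powi (2 * z - int d) - q powi int d) * q powi (2 * z + 1 - int d) * inverse t
    - (q powi (- int d) - q powi (2 * z - int d)) * (1 - inverse t * q powi (2 * z - 1 - int d))" for z
  define su where "su z = (q powi (2 * z - 2 - int d) - q powi int d)
    * q powi (2 * z - 1 - int d) * inverse t" for z
  define sl where "sl z = (q powi (- int d) - q powi (2 * z + 2 - int d))
    * (1 - inverse t * q powi (2 * z + 1 - int d))" for z
  have E: "x 1 2 (u z) = \<theta> z *s u z + e z *s u (z - 1)" for z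
  proof -
    have "x 1 2 (u z) = \<theta> z *s u z + e z *s u (z - 1) + 0 *s u (z + 1)"
      by (rule tridiagonal_action[OF x12 len x_zero[OF st(2)] _ _ _ u_def])
        (auto simp: E_mat_def \<theta>_def e_def)
    then show ?thesis by simp
  qed
  have K: "x 2 3 (u z) = q powi (int d - 2 * z) *s u z" for z
  proof -
    have "x 2 3 (u z) = q powi (int d - 2 * z) *s u z + 0 *s u (z - 1) + 0 *s u (z + 1)"
      by (rule tridiagonal_action[OF x23 len x_zero[OF st(3)] _ _ _ u_def])
        (auto simp: K_mat_def)
    then show ?thesis by simp
  qed
  have Gc: "G_mat d (inverse q) t \<in> carrier_mat (d + 1) (d + 1)" by (simp add: G_mat_def)
  have G: "x 3 0 (u z) = \<theta> z *s u z + g z *s u (z + 1)" for z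
  proof -
    have entry: "(Z_mat d * G_mat d (inverse q) t * Z_mat d) $$ (i, n)
        = (if i = n then \<theta> (int n) else if n = i + 1 then 0 else if i = n + 1 then g (int n) else 0)"
      if "i \<le> d" "n \<le> d" for i n
    proof -
      have G_entry: "G_mat d (inverse q) t $$ (d - i, d - n)
          = (if d - i = d - n then inverse q powi (2 * int (d - i) - int d)
             else if d - n = d - i + 1 then
               (inverse q ^ d - inverse q powi (2 * int (d - n) - 2 - int d))
               * (1 - t * inverse q powi (int d - 2 * int (d - n) + 1))
             else 0)"
        unfolding G_mat_def by simp
      have ex: "- (2 * int (d - i) - int d) = 2 * int i - int d"
        "- (2 * int (d - n) - 2 - int d) = 2 * int n + 2 - int d"
        "- (int d - 2 * int (d - n) + 1) = int d - 2 * int n - 1"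
        using that by (simp_all add: of_nat_diff)
      have iff: "d - i = d - n \<longleftrightarrow> i = n" "d - n = d - i + 1 \<longleftrightarrow> i = n + 1"
        using that by auto
      show ?thesis
        unfolding Z_mat_conjugate_index[OF Gc that] G_entry inv ex iff \<theta>_def g_def by auto
    qed
    have "x 3 0 (u z) = \<theta> z *s u z + 0 *s u (z - 1) + g z *s u (z + 1)"
      by (rule tridiagonal_action[OF x30 len x_zero[OF st(4)] entry _ _ u_def])
        (simp_all add: g_def)
    then show ?thesis by simp
  qed
  have Sc: "S_mat d (inverse q) (inverse t) \<in> carrier_mat (d + 1) (d + 1)" by (simp add: S_mat_def)
  have S: "x 0 1 (u z) = sd z *s u z + su z *s u (z - 1) + sl z *s u (z + 1)" for z
  proof -
    have entry: "(Z_mat d * S_mat d (inverse q) (inverse t) * Z_mat d) $$ (i, n)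
        = (if i = n then sd (int n) else if n = i + 1 then su (int n)
           else if i = n + 1 then sl (int n) else 0)"
      if "i \<le> d" "n \<le> d" for i n
    proof -
      have S_entry: "S_mat d (inverse q) (inverse t) $$ (d - i, d - n)
          = (if d - n = d - i + 1 then
               (inverse q ^ d - inverse q powi (2 * int (d - n) - int d - 2))
               * (1 - inverse t * inverse q powi (2 * int (d - n) - int d - 1))
             else if d - i = d - n + 1 then
               (inverse q powi (2 * int (d - i) - int d) - inverse q powi (- int d))
               * inverse q powi (2 * int (d - i) - int d - 1) * inverse t
             else if d - i = d - n then
               inverse q ^ d
               - (inverse q powi (2 * int (d - i) - int d) - inverse q powi (- int d))
                 * inverse q powi (2 * int (d - i) - int d - 1) * inverse t
               - (inverse q ^ d - inverse q powi (2 * int (d - i) - int d))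
                 * (1 - inverse t * inverse q powi (2 * int (d - i) - int d + 1))
             else 0)"
        unfolding S_mat_def using that by simp
      have ex: "- (2 * int (d - i) - int d) = 2 * int i - int d"
        "- (2 * int (d - i) - int d - 1) = 2 * int i + 1 - int d"
        "- (2 * int (d - i) - int d + 1) = 2 * int i - 1 - int d"
        "- (2 * int (d - n) - int d - 1) = 2 * int n + 1 - int d"
        "- (2 * int (d - n) - int d - 2) = 2 * int n + 2 - int d"
        "- (- int d) = int d"
        using that by (simp_all add: of_nat_diff)
      have iff: "d - i = d - n \<longleftrightarrow> i = n" "d - n = d - i + 1 \<longleftrightarrow> i = n + 1"
        "d - i = d - n + 1 \<longleftrightarrow> n = i + 1"
        using that by auto
      have ex': "2 * int (i + 1) - 2 - int d = 2 * int i - int d"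
        "2 * int (i + 1) - 1 - int d = 2 * int i + 1 - int d"
        by simp_all
      have su_Suc: "su (int (i + 1)) = (q powi (2 * int i - int d) - q powi int d)
          * q powi (2 * int i + 1 - int d) * inverse t"
        unfolding su_def ex' ..
      consider "i = n" | "n = i + 1" | "i = n + 1" | "i \<noteq> n" "n \<noteq> i + 1" "i \<noteq> n + 1" by blast
      then show ?thesis
      proof cases
        case 2
        then have "su (int n) = su (int (i + 1))" by simp
        with 2 show ?thesis
          unfolding Z_mat_conjugate_index[OF Sc that] S_entry inv ex iff su_Suc by simp
      qed (unfold Z_mat_conjugate_index[OF Sc that] S_entry inv ex iff, simp_all add: sd_def sl_def)
    qed
    show ?thesis
      by (rule tridiagonal_action[OF x01 len x_zero[OF st(1)] entry _ _ u_def])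
        (simp_all add: su_def sl_def)
  qed
  have in_range: "v \<in> range u" if "v \<in> set vs" for v
  proof -
    obtain n where "n < d + 1" "v = vs ! n" using \<open>v \<in> set vs\<close> len by (auto simp: in_set_conv_nth)
    then have "v = u (int n)" by (simp add: u_def)
    then show ?thesis by simp
  qed
  have span: "span (set vs) = UNIV" using basis by (simp add: is_basis_def)
  show "evaluation_relation 0 t"
  proof (rule evaluation_relation_on_basis[OF span])
    fix v assume "v \<in> set vs"
    then obtain z where v: "v = u z" using in_range by blast
    have c1: "(q - inverse q) * t * su z = e z * (\<theta> (z - 1) - \<theta> z)"
      using q_nonzero t by (simp_all add: su_def sl_def sd_def e_def g_def \<theta>_def q_powi_expand field_simps power2_eq_square)
    have c2: "(q - inverse q) * t * (sd z - q powi (int d - 2 * z)) = e z * g (z - 1) - g z * e (z + 1)"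
      using q_nonzero t by (simp_all add: su_def sl_def sd_def e_def g_def \<theta>_def q_powi_expand field_simps power2_eq_square)
    have c3: "(q - inverse q) * t * sl z = g z * (\<theta> z - \<theta> (z + 1))"
      using q_nonzero t by (simp_all add: su_def sl_def sd_def e_def g_def \<theta>_def q_powi_expand field_simps power2_eq_square)
    have "x 3 0 (x 1 2 v) - x 1 2 (x 3 0 v)
        = (e z * (\<theta> (z - 1) - \<theta> z)) *s u (z - 1) + (e z * g (z - 1) - g z * e (z + 1)) *s u z
          + (g z * (\<theta> z - \<theta> (z + 1))) *s u (z + 1)"
      unfolding v E G using st by (simp add: x_add x_scale E G algebra_simps)
    also have "\<dots> = ((q - inverse q) * t) *s (x 0 1 v - x 2 3 v)"
      unfolding v S K c1[symmetric] c2[symmetric] c3[symmetric] by (simp add: algebra_simps)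
    finally show "((q - inverse q) * t) *s (x 0 (0 + 1) v - x (0 + 2) (0 + 3) v)
        = x (0 + 3) 0 (x (0 + 1) (0 + 2) v) - x (0 + 1) (0 + 2) (x (0 + 3) 0 v)"
      by simp
  qed
  show "evaluation_relation 1 (inverse t)"
  proof (rule evaluation_relation_on_basis[OF span])
    fix v assume "v \<in> set vs"
    then obtain z where v: "v = u z" using in_range by blast
    have c1: "(q - inverse q) * inverse t * e z
        = su z * (q powi (int d - 2 * z) - q powi (int d - 2 * (z - 1)))"
      using q_nonzero t by (simp_all add: su_def sl_def sd_def e_def g_def \<theta>_def q_powi_expand field_simps power2_eq_square)
    have c2: "- ((q - inverse q) * inverse t * g z)
        = sl z * (q powi (int d - 2 * z) - q powi (int d - 2 * (z + 1)))"
      using q_nonzero t by (simp_all add: su_def sl_def sd_def e_def g_def \<theta>_def q_powi_expand field_simps power2_eq_square)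
    have "x 0 1 (x 2 3 v) - x 2 3 (x 0 1 v)
        = (su z * (q powi (int d - 2 * z) - q powi (int d - 2 * (z - 1)))) *s u (z - 1)
          + (sl z * (q powi (int d - 2 * z) - q powi (int d - 2 * (z + 1)))) *s u (z + 1)"
      unfolding v S K using st by (simp add: x_add x_scale S K algebra_simps)
    also have "\<dots> = ((q - inverse q) * inverse t) *s (x 1 2 v - x 3 0 v)"
      unfolding v E G c1[symmetric] c2[symmetric] by (simp add: algebra_simps)
    finally show "((q - inverse q) * inverse t) *s (x 1 (1 + 1) v - x (1 + 2) (1 + 3) v)
        = x (1 + 3) 1 (x (1 + 1) (1 + 2) v) - x (1 + 1) (1 + 2) (x (1 + 3) 1 v)"
      by (simp add: four)
  qed
qed

end

section \<open>Normalized bases\<close>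

definition diag_matrix :: "nat \<Rightarrow> (nat \<Rightarrow> 'a::zero) \<Rightarrow> 'a mat" where
  "diag_matrix d g = mat (d + 1) (d + 1) (\<lambda>(i, j). if i = j then g i else 0)"

lemma diag_matrix_mult:
  fixes f g :: "nat \<Rightarrow> 'a::semiring_1"
  shows "diag_matrix d f * diag_matrix d g = diag_matrix d (\<lambda>n. f n * g n)"
proof (rule eq_matI)
  fix i j assume "i < dim_row (diag_matrix d (\<lambda>n. f n * g n))"
    and "j < dim_col (diag_matrix d (\<lambda>n. f n * g n))"
  then have ij: "i < d + 1" "j < d + 1" by (simp_all add: diag_matrix_def)
  have "(diag_matrix d f * diag_matrix d g) $$ (i, j)
      = (\<Sum>k\<in>{0..<d + 1}. diag_matrix d f $$ (i, k) * diag_matrix d g $$ (k, j))"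
    using ij by (intro mult_mat_index_sum) (simp_all add: diag_matrix_def)
  also have "\<dots> = (\<Sum>k\<in>{0..<d + 1}. if i = k then f i * (if k = j then g k else 0) else 0)"
    using ij by (intro sum.cong) (auto simp: diag_matrix_def)
  also have "\<dots> = diag_matrix d (\<lambda>n. f n * g n) $$ (i, j)"
    using ij by (simp add: diag_matrix_def del: sum.op_ivl_Suc)
  finally show "(diag_matrix d f * diag_matrix d g) $$ (i, j)
      = diag_matrix d (\<lambda>n. f n * g n) $$ (i, j)" .
qed (simp_all add: diag_matrix_def)

lemma mat_inv_diag_matrix:
  fixes g :: "nat \<Rightarrow> 'a::field"
  assumes "\<And>n. n \<le> d \<Longrightarrow> g n \<noteq> 0"
  shows "mat_inv (diag_matrix d g) = diag_matrix d (\<lambda>n. inverse (g n))"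
proof -
  let ?A = "diag_matrix d g" and ?B = "diag_matrix d (\<lambda>n. inverse (g n))"
  have c: "?A \<in> carrier_mat (d + 1) (d + 1)" "?B \<in> carrier_mat (d + 1) (d + 1)"
    by (simp_all add: diag_matrix_def)
  have one: "diag_matrix d f = 1\<^sub>m (d + 1)" if "\<And>n. n \<le> d \<Longrightarrow> f n = 1" for f :: "nat \<Rightarrow> 'a"
    using that by (intro eq_matI) (auto simp: diag_matrix_def)
  have AB: "?A * ?B = 1\<^sub>m (d + 1)" "?B * ?A = 1\<^sub>m (d + 1)"
    using assms by (simp_all add: diag_matrix_mult one)
  show ?thesis
  proof (cases "mat_inverse ?A")
    case None
    have "?A \<in> Units (ring_mat TYPE('a) (d + 1) ())"
      using AB c by (auto simp: Units_def ring_mat_def)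
    then show ?thesis using mat_inverse(1)[OF c(1) None, where b = "()"] by blast
  next
    case (Some C)
    then have C: "?A * C = 1\<^sub>m (d + 1)" "C * ?A = 1\<^sub>m (d + 1)" "C \<in> carrier_mat (d + 1) (d + 1)"
      using mat_inverse(2)[OF c(1) Some] by auto
    have "C = C * (?A * ?B)" using AB C(3) by simp
    also have "\<dots> = ?B" using C c by (simp flip: assoc_mult_mat)
    finally show ?thesis using Some by (simp add: mat_inv_def)
  qed
qed

context generic_evaluation_module begin

text \<open>
  Components of the decompositions \<open>[k,l]\<close> with \<open>l - k = 3\<close> run through the
  eigenspaces in reverse order. Independence and spanning only depend on the enumeration being
  bijective, so all pairs are covered at once.
\<close>

lemma decomposition_as_eig:
  assumes "k \<noteq> l"
  obtains k' l' p where "standard_pair k' l'" "bij_betw p {..d} {0..int d}"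
    "\<forall>n\<le>d. decomposition UNIV scale q x d k l n = eig k' l' (p n)"
proof (cases "standard_pair k l")
  case True
  show thesis
  proof
    show "standard_pair k l" by (rule True)
    show "bij_betw int {..d} {0..int d}"
      by (rule bij_betw_byWitness[of _ nat]) auto
    show "\<forall>n\<le>d. decomposition UNIV scale q x d k l n = eig k l (int n)"
      using True by (simp add: decomposition_def eigenspace_on_def eig_def)
  qed
next
  case False
  have "l - k = 0 \<or> l - k = 1 \<or> l - k = 2 \<or> l - k = 3" by (rule z4_exhaust)
  then have "l - k = 3" using assms False by (auto simp: standard_pair_def)
  moreover have "k - l = - (l - k)" by simp
  ultimately have lk: "standard_pair l k" by (simp add: standard_pair_def)
  show thesis
  proof
    show "standard_pair l k" by (rule lk)
    show "bij_betw (\<lambda>n. int (d - n)) {..d} {0..int d}"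
      by (rule bij_betw_byWitness[of _ "\<lambda>z. d - nat z"]) auto
    show "\<forall>n\<le>d. decomposition UNIV scale q x d k l n = eig l k (int (d - n))"
      using False by (simp add: decomposition_def eigenspace_on_def eig_def)
  qed
qed

lemma subspace_decomposition:
  assumes "k \<noteq> l" "n \<le> d"
  shows "subspace (decomposition UNIV scale q x d k l n)"
proof -
  obtain k' l' p where "standard_pair k' l'" "bij_betw p {..d} {0..int d}"
    "\<forall>n\<le>d. decomposition UNIV scale q x d k l n = eig k' l' (p n)"
    by (rule decomposition_as_eig[OF assms(1)])
  then show ?thesis using assms(2) subspace_eig by simp
qed

lemma decomposition_sum_zero:
  assumes "k \<noteq> l" "\<And>n. n \<le> d \<Longrightarrow> w n \<in> decomposition UNIV scale q x d k l n"
    and "(\<Sum>n\<le>d. w n) = 0" and "n \<le> d"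
  shows "w n = 0"
proof -
  obtain k' l' p where p: "standard_pair k' l'" "bij_betw p {..d} {0..int d}"
    "\<forall>n\<le>d. decomposition UNIV scale q x d k l n = eig k' l' (p n)"
    by (rule decomposition_as_eig[OF assms(1)])
  let ?r = "inv_into {..d} p"
  have r: "?r (p m) = m" if "m \<le> d" for m
    using p(2) that by (intro inv_into_f_f) (auto simp: bij_betw_def)
  have "w (?r (p n)) = 0"
  proof (rule eig_sum_zero[OF p(1), of "{0..int d}" "\<lambda>z. w (?r z)"])
    have "(\<Sum>z\<in>{0..int d}. w (?r z)) = (\<Sum>m\<le>d. w (?r (p m)))"
      by (rule sum.reindex_bij_betw[OF p(2), symmetric])
    then show "(\<Sum>z\<in>{0..int d}. w (?r z)) = 0" using assms(3) by (simp add: r)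
    show "p n \<in> {0..int d}" using p(2) assms(4) by (auto simp: bij_betw_def)
    fix z assume "z \<in> {0..int d}"
    then have "z \<in> p ` {..d}" using p(2) by (simp add: bij_betw_def)
    then obtain m where "m \<le> d" "z = p m" by auto
    then show "w (?r z) \<in> eig k' l' z" using assms(2)[of m] p(3) by (simp add: r)
  qed simp
  then show ?thesis using r[OF assms(4)] by simp
qed

lemma decomposition_unique:
  assumes "k \<noteq> l" "\<And>n. n \<le> d \<Longrightarrow> u n \<in> decomposition UNIV scale q x d k l n"
    "\<And>n. n \<le> d \<Longrightarrow> w n \<in> decomposition UNIV scale q x d k l n"
    and "(\<Sum>n\<le>d. u n) = (\<Sum>n\<le>d. w n)" and "n \<le> d"
  shows "u n = w n"
proof -
  have "u n - w n = 0"
  proof (rule decomposition_sum_zero[OF assms(1) _ _ assms(5), of "\<lambda>n. u n - w n"])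
    fix n assume n: "n \<le> d"
    show "u n - w n \<in> decomposition UNIV scale q x d k l n"
      by (rule subspace_diff[OF subspace_decomposition[OF assms(1) n] assms(2,3)[OF n]])
  qed (use assms(4) in \<open>simp add: sum_subtractf\<close>)
  then show ?thesis by simp
qed

lemma decomposition_spans:
  assumes "k \<noteq> l" "\<And>n. n \<le> d \<Longrightarrow> w n \<in> decomposition UNIV scale q x d k l n"
    and "\<And>n. n \<le> d \<Longrightarrow> w n \<noteq> 0"
  obtains c where "v = (\<Sum>n\<le>d. c n *s w n)"
proof -
  obtain k' l' p where p: "standard_pair k' l'" "bij_betw p {..d} {0..int d}"
    "\<forall>n\<le>d. decomposition UNIV scale q x d k l n = eig k' l' (p n)"
    by (rule decomposition_as_eig[OF assms(1)])
  obtain u where u: "resolves k' l' v u" using resolves_exists[OF p(1)] by blast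
  have "\<exists>c. u (p n) = c *s w n" if "n \<le> d" for n
    by (rule eig_proportional[OF p(1), of _ "p n"])
      (use that assms p u in \<open>auto simp: resolves_def\<close>)
  then obtain c where c: "\<And>n. n \<le> d \<Longrightarrow> u (p n) = c n *s w n" by metis
  have "v = (\<Sum>n\<le>d. u (p n))"
    using u sum.reindex_bij_betw[OF p(2), of u] by (simp add: resolves_def)
  then show thesis using that[of c] c by simp
qed

lemma is_basis_decomposition:
  assumes "k \<noteq> l" "\<And>n. n \<le> d \<Longrightarrow> w n \<in> decomposition UNIV scale q x d k l n"
    and "\<And>n. n \<le> d \<Longrightarrow> w n \<noteq> 0"
  shows "is_basis scale (map w [0..<Suc d])"
proof -
  have zero: "c n = 0" if "(\<Sum>n\<le>d. c n *s w n) = 0" "n \<le> d" for c n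
  proof -
    have "c n *s w n = 0"
    proof (rule decomposition_sum_zero[OF assms(1) _ that])
      fix n assume n: "n \<le> d"
      show "c n *s w n \<in> decomposition UNIV scale q x d k l n"
        by (rule subspace_scale[OF subspace_decomposition[OF assms(1) n] assms(2)[OF n]])
    qed
    then show ?thesis using assms(3) that by simp
  qed
  have inj: "inj_on w {..d}"
  proof (rule inj_onI, rule ccontr)
    fix m n assume mn: "m \<in> {..d}" "n \<in> {..d}" "w m = w n" "m \<noteq> n"
    let ?c = "\<lambda>i. if i = m then 1 else if i = n then - 1 else 0"
    have "(\<Sum>i\<le>d. ?c i *s w i) = (\<Sum>i\<in>{m, n}. ?c i *s w i)"
      using mn by (intro sum.mono_neutral_right) auto
    also have "\<dots> = 0" using mn by simp
    finally show False using zero[of ?c m] mn by simp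
  qed
  have set: "set (map w [0..<Suc d]) = w ` {..d}"
    by (simp add: atLeast0LessThan lessThan_Suc_atMost del: upt_Suc)
  have "independent (w ` {..d})"
  proof (rule independent_if_scalars_zero)
    fix f v assume f: "(\<Sum>v\<in>w ` {..d}. f v *s v) = 0" and "v \<in> w ` {..d}"
    then obtain n where n: "n \<le> d" "v = w n" by auto
    have "(\<Sum>n\<le>d. f (w n) *s w n) = 0" using f by (simp add: sum.reindex[OF inj])
    then show "f v = 0" using zero[of "\<lambda>n. f (w n)" n] n by simp
  qed simp
  moreover have "span (w ` {..d}) = UNIV"
  proof -
    have "v \<in> span (w ` {..d})" for v
    proof -
      obtain c where v: "v = (\<Sum>n\<le>d. c n *s w n)" by (rule decomposition_spans[OF assms])
      show ?thesis unfolding v by (rule span_sum, rule span_scale, rule span_base) simp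
    qed
    then show ?thesis by auto
  qed
  moreover have "distinct (map w [0..<Suc d])"
    using inj by (simp add: distinct_map atLeast0LessThan lessThan_Suc_atMost del: upt_Suc)
  ultimately show ?thesis unfolding is_basis_def set by simp
qed

text \<open>
  This evaluates the definite description: the components of a vector in a decomposition are
  unique, and they form a basis once none of them vanishes.
\<close>

lemma normalized_basis_eq:
  assumes "k \<noteq> l" "\<And>n. n \<le> d \<Longrightarrow> w n \<in> decomposition UNIV scale q x d k l n"
    and "\<And>n. n \<le> d \<Longrightarrow> w n \<noteq> 0" and "\<eta> j = (\<Sum>n\<le>d. w n)"
  shows "normalized_basis scale q x d \<eta> i j k l = map w [0..<Suc d]"
  unfolding normalized_basis_def
proof (rule the_equality, intro conjI allI impI)
  show "is_basis scale (map w [0..<Suc d])" by (rule is_basis_decomposition[OF assms(1-3)])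
  have nth: "map w [0..<Suc d] ! n = w n" if "n \<le> d" for n
    using that by (simp del: upt_Suc)
  show "length (map w [0..<Suc d]) = d + 1" by simp
  show "map w [0..<Suc d] ! n \<in> decomposition UNIV scale q x d k l n" if "n \<le> d" for n
    using assms(2) that nth by simp
  show "\<eta> j = (\<Sum>n\<le>d. map w [0..<Suc d] ! n)" using assms(4) nth by simp
  fix us
  assume us: "length us = d + 1 \<and> is_basis scale us \<and>
    (\<forall>n\<le>d. us ! n \<in> decomposition UNIV scale q x d k l n) \<and> \<eta> j = (\<Sum>n\<le>d. us ! n)"
  have "us ! n = w n" if "n \<le> d" for n
    by (rule decomposition_unique[OF assms(1) _ _ _ that]) (use us assms in auto)
  then show "us = map w [0..<Suc d]"
    using us nth by (intro nth_equalityI) (auto simp del: upt_Suc)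
qed

lemma is_transition_matrix_diagonal:
  assumes "is_basis scale (map w [0..<Suc d])" "is_basis scale (map w' [0..<Suc d])"
    and "\<And>n. n \<le> d \<Longrightarrow> w' n = g n *s w n"
  shows "is_transition_matrix scale (map w [0..<Suc d]) (map w' [0..<Suc d]) (diag_matrix d g)"
  unfolding is_transition_matrix_def
proof (intro conjI allI impI)
  fix n assume "n < length (map w [0..<Suc d])"
  then have n: "n < Suc d" by simp
  have "(\<Sum>r<length (map w [0..<Suc d]). diag_matrix d g $$ (r, n) *s map w [0..<Suc d] ! r)
      = (\<Sum>r<Suc d. if r = n then g n *s w n else 0)"
    using n by (intro sum.cong) (auto simp: diag_matrix_def simp del: upt_Suc)
  also have "\<dots> = map w' [0..<Suc d] ! n"
    using n assms(3)[of n] by (simp del: upt_Suc)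
  finally show "map w' [0..<Suc d] ! n
      = (\<Sum>r<length (map w [0..<Suc d]). diag_matrix d g $$ (r, n) *s map w [0..<Suc d] ! r)" ..
qed (use assms in \<open>simp_all add: diag_matrix_def\<close>)

section \<open>Flag vectors of the dual space\<close>

definition dual_flag_vector :: "4 \<Rightarrow> ('v \<Rightarrow> 'f) \<Rightarrow> bool" where
  "dual_flag_vector l f \<longleftrightarrow> Vector_Spaces.linear scale (*) f \<and> f \<noteq> (\<lambda>v. 0) \<and>
     (\<forall>v. f (x l (l + 1) v) = q powi (- int d) * f v)"

lemma functional_scale: "Vector_Spaces.linear scale (*) f \<Longrightarrow> f (c *s v) = c * f v"
  by (simp add: Vector_Spaces.linear_iff)

lemma functional_diff: "Vector_Spaces.linear scale (*) f \<Longrightarrow> f (u - v) = f u - f v"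
  by (metis linear_iff_module_hom module_hom.diff)

lemma functional_sum: "Vector_Spaces.linear scale (*) f \<Longrightarrow> f (\<Sum>a\<in>A. u a) = (\<Sum>a\<in>A. f (u a))"
  by (metis linear_iff_module_hom module_hom.sum)

lemma functional_vanishes_on_eig:
  assumes f: "Vector_Spaces.linear scale (*) f"
    and "\<And>v. f (x k l v) = q powi (int d - 2 * y) * f v"
    and "u \<in> eig k l z" "z \<noteq> y"
  shows "f u = 0"
proof -
  have "q powi (int d - 2 * y) * f u = q powi (int d - 2 * z) * f u"
    unfolding assms(2)[symmetric] eigD[OF assms(3)] by (rule functional_scale[OF f])
  then show ?thesis using assms(4) by (simp add: q_powi_inject)
qed

text \<open>
  The transpose of \<open>eig_0_imp_eig_d\<close>, checked on each eigenspace of \<open>x l (l + 1)\<close>.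
  On the eigenspace with eigenvalue \<open>q\<^sup>-\<^sup>d\<close> it is the Weyl relation. On the others
  \<open>f\<close> vanishes, and the Weyl relation then yields \<open>f (x k l u) = 0\<close> after division by
  a factor that is zero only for the eigenvalue \<open>q\<^sup>-\<^sup>d\<^sup>-\<^sup>2\<close>, which does not occur.
\<close>

lemma dual_flag_vector_weyl:
  assumes T: "weyl_triple k l (l + 1)" and f: "dual_flag_vector l f"
  shows "f (x k l v) = q powi int d * f v"
proof -
  note st = weyl_triple_standard[OF T]
  have lin: "Vector_Spaces.linear scale (*) f"
    and fy: "\<And>v. f (x l (l + 1) v) = q powi (int d - 2 * int d) * f v"
    using f by (simp_all add: dual_flag_vector_def)
  obtain u where u: "resolves l (l + 1) v u" using resolves_exists[OF st(2)] by blast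
  have "f (x k l (u z)) = q powi int d * f (u z)" for z
  proof -
    have uz: "u z \<in> eig l (l + 1) z" using u by (simp add: resolves_def)
    have "f (q *s x k l (x l (l + 1) (u z)) - inverse q *s x l (l + 1) (x k l (u z)))
        = f ((q - inverse q) *s u z)"
      by (simp only: weyl_relation[OF T])
    then have *: "(q * q powi (int d - 2 * z) - inverse q * q powi (- int d)) * f (x k l (u z))
        = (q - inverse q) * f (u z)"
      using st eigD[OF uz] fy
      by (simp add: functional_diff[OF lin] functional_scale[OF lin] x_scale algebra_simps)
    show ?thesis
    proof (cases "z = int d")
      case True
      have "q * q powi (int d - 2 * z) - inverse q * q powi (- int d) = (q - inverse q) * q powi (- int d)"
        using True by (simp add: algebra_simps)
      with * have "(q - inverse q) * (q powi (- int d) * f (x k l (u z))) = (q - inverse q) * f (u z)"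
        by (simp add: mult.assoc)
      then have "q powi (- int d) * f (x k l (u z)) = f (u z)"
        using q_minus_inverse_nonzero by simp
      then show ?thesis
        using q_nonzero by (simp add: power_int_minus field_simps)
    next
      case False
      then have fu: "f (u z) = 0"
        by (intro functional_vanishes_on_eig[OF lin fy uz])
      show ?thesis
      proof (cases "z = int d + 1")
        case True
        then have "u z = 0" using uz by (intro eig_outside[OF st(2)]) auto
        then show ?thesis using st functional_scale[OF lin, of 0 0] by (simp add: x_zero)
      next
        case False
        have "q * q powi (int d - 2 * z) = q powi (int d - 2 * z + 1)"
          "inverse q * q powi (- int d) = q powi (- int d - 1)"
          using q_nonzero by (simp_all add: power_int_add power_int_diff field_simps)
        then have "q * q powi (int d - 2 * z) - inverse q * q powi (- int d) \<noteq> 0"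
          using False by (simp add: q_powi_inject)
        then show ?thesis using * fu by simp
      qed
    qed
  qed
  then show ?thesis
    using u st by (simp add: resolves_def x_sum functional_sum[OF lin] sum_distrib_left)
qed

text \<open>
  The functional \<open>f\<close> is an eigenvector of the transpose of the generator that defines
  \<open>[k,l]\<close>, with the eigenvalue belonging to component 0, so it kills the other components.
\<close>

lemma dual_flag_vector_decomposition:
  assumes kl: "k \<noteq> l" and f: "dual_flag_vector l f"
    and w: "\<And>n. n \<le> d \<Longrightarrow> w n \<in> decomposition UNIV scale q x d k l n"
  shows "f (\<Sum>n\<le>d. w n) = f (w 0)"
proof -
  have lin: "Vector_Spaces.linear scale (*) f"
    and fy: "\<And>v. f (x l (l + 1) v) = q powi (int d - 2 * int d) * f v"
    using f by (simp_all add: dual_flag_vector_def)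
  have vanish: "f (w n) = 0" if n: "n \<le> d" "n \<noteq> 0" for n
  proof (cases "standard_pair k l")
    case True
    have "weyl_triple k l (l + 1)"
      using True by (auto simp: standard_pair_def weyl_triple_def)
    then have "f (x k l v) = q powi (int d - 2 * 0) * f v" for v
      using dual_flag_vector_weyl[OF _ f] by simp
    moreover have "w n \<in> eig k l (int n)"
      using w[OF n(1)] True by (simp add: decomposition_def eigenspace_on_def eig_def)
    ultimately show ?thesis using n by (intro functional_vanishes_on_eig[OF lin, of k l 0]) auto
  next
    case False
    have "l - k = 0 \<or> l - k = 1 \<or> l - k = 2 \<or> l - k = 3" by (rule z4_exhaust)
    then have "l - k = 3" using kl False by (auto simp: standard_pair_def)
    moreover have "k = l - (l - k)" by simp
    ultimately have "k = l + 1" by simp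
    then have "w n \<in> eig l (l + 1) (int (d - n))"
      using w[OF n(1)] False by (simp add: decomposition_def eigenspace_on_def eig_def)
    then show ?thesis using n by (intro functional_vanishes_on_eig[OF lin fy]) auto
  qed
  have "f (\<Sum>n\<le>d. w n) = (\<Sum>n\<le>d. f (w n))" by (rule functional_sum[OF lin])
  also have "\<dots> = (\<Sum>n\<in>{0}. f (w n))"
    by (rule sum.mono_neutral_right) (auto simp: vanish)
  finally show ?thesis by simp
qed

lemma dual_flag_vector_leading_nonzero:
  assumes kl: "k \<noteq> l" and f: "dual_flag_vector l f"
    and w: "\<And>n. n \<le> d \<Longrightarrow> w n \<in> decomposition UNIV scale q x d k l n"
    and w0: "\<And>n. n \<le> d \<Longrightarrow> w n \<noteq> 0"
  shows "f (w 0) \<noteq> 0"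
proof
  assume 0: "f (w 0) = 0"
  have lin: "Vector_Spaces.linear scale (*) f" using f by (simp add: dual_flag_vector_def)
  have "f v = 0" for v
  proof -
    obtain c where v: "v = (\<Sum>n\<le>d. c n *s w n)" by (rule decomposition_spans[OF kl w w0])
    have "f v = f (c 0 *s w 0)" unfolding v
      by (rule dual_flag_vector_decomposition[OF kl f])
        (rule subspace_scale[OF subspace_decomposition[OF kl] w])
    then show ?thesis using 0 by (simp add: functional_scale[OF lin])
  qed
  then show False using f by (auto simp: dual_flag_vector_def)
qed

section \<open>Transition matrices\<close>

text \<open>
  The scalars \<open>c\<close> are the diagonal entries of the transition matrix. They are known up to
  their first value \<open>c 0\<close>, which is the quotient of the values of \<open>f\<close> at the two
  normalizing vectors.
\<close>

lemma transition_between_normalized_bases: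
  assumes kl: "k \<noteq> l" and f: "dual_flag_vector l f"
    and w: "\<And>n. n \<le> d \<Longrightarrow> w n \<in> decomposition UNIV scale q x d k l n"
    and w0: "\<And>n. n \<le> d \<Longrightarrow> w n \<noteq> 0" and c0: "\<And>n. n \<le> d \<Longrightarrow> c n \<noteq> 0"
    and \<eta>: "\<eta> j = (\<Sum>n\<le>d. w n)" "\<eta> j' = (\<Sum>n\<le>d. c n *s w n)"
    and g: "\<And>n. n \<le> d \<Longrightarrow> c n = c 0 * g n"
  shows "is_transition_matrix scale (normalized_basis scale q x d \<eta> i j k l)
      (normalized_basis scale q x d \<eta> i' j' k l)
      ((f (\<eta> j') / f (\<eta> j)) \<cdot>\<^sub>m diag_matrix d g)"
    and "is_transition_matrix scale (normalized_basis scale q x d \<eta> i' j' k l)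
      (normalized_basis scale q x d \<eta> i j k l)
      ((f (\<eta> j) / f (\<eta> j')) \<cdot>\<^sub>m mat_inv (diag_matrix d g))"
proof -
  have lin: "Vector_Spaces.linear scale (*) f" using f by (simp add: dual_flag_vector_def)
  have cw: "c n *s w n \<in> decomposition UNIV scale q x d k l n" if "n \<le> d" for n
    by (rule subspace_scale[OF subspace_decomposition[OF kl that] w[OF that]])
  have cw0: "c n *s w n \<noteq> 0" if "n \<le> d" for n
    using w0[OF that] c0[OF that] by simp
  have B: "normalized_basis scale q x d \<eta> i j k l = map w [0..<Suc d]"
    by (rule normalized_basis_eq[where \<eta> = \<eta> and j = j, OF kl w w0 \<eta>(1)])
  have B': "normalized_basis scale q x d \<eta> i' j' k l = map (\<lambda>n. c n *s w n) [0..<Suc d]"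
    by (rule normalized_basis_eq[where \<eta> = \<eta> and j = j', OF kl cw cw0 \<eta>(2)])
  note bases = is_basis_decomposition[OF kl w w0] is_basis_decomposition[OF kl cw cw0]
  have "f (\<eta> j) = f (w 0)" "f (\<eta> j') = c 0 * f (w 0)"
    unfolding \<eta> using dual_flag_vector_decomposition[OF kl f w]
      dual_flag_vector_decomposition[OF kl f cw] by (simp_all add: functional_scale[OF lin])
  then have \<rho>: "f (\<eta> j') / f (\<eta> j) = c 0" "f (\<eta> j) / f (\<eta> j') = inverse (c 0)"
    using dual_flag_vector_leading_nonzero[OF kl f w w0] by (simp_all add: divide_simps)
  have g0: "g n \<noteq> 0" if "n \<le> d" for n using g[OF that] c0[OF that] by auto
  have inv: "mat_inv (diag_matrix d g) = diag_matrix d (\<lambda>n. inverse (g n))"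
    by (rule mat_inv_diag_matrix) (rule g0)
  have smult: "a \<cdot>\<^sub>m diag_matrix d h = diag_matrix d (\<lambda>n. a * h n)" for a and h :: "nat \<Rightarrow> 'f"
    by (rule eq_matI) (auto simp: diag_matrix_def)
  show "is_transition_matrix scale (normalized_basis scale q x d \<eta> i j k l)
      (normalized_basis scale q x d \<eta> i' j' k l)
      ((f (\<eta> j') / f (\<eta> j)) \<cdot>\<^sub>m diag_matrix d g)"
    unfolding B B' \<rho> smult
  proof (rule is_transition_matrix_diagonal[OF bases])
    show "c n *s w n = (c 0 * g n) *s w n" if "n \<le> d" for n
      using g[OF that] by (rule arg_cong)
  qed
  show "is_transition_matrix scale (normalized_basis scale q x d \<eta> i' j' k l)
      (normalized_basis scale q x d \<eta> i j k l)
      ((f (\<eta> j) / f (\<eta> j')) \<cdot>\<^sub>m mat_inv (diag_matrix d g))"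
    unfolding B B' \<rho> inv smult
  proof (rule is_transition_matrix_diagonal[OF bases(2,1)])
    fix n assume n: "n \<le> d"
    have "inverse (c 0) * inverse (g n) * c n = 1"
      using g[OF n] c0[OF n] c0[of 0] g0[OF n] by (simp add: field_simps)
    then show "w n = (inverse (c 0) * inverse (g n)) *s c n *s w n"
      by simp
  qed
qed

end

lemma qpoch_Suc_left: "qpoch a p (Suc n) = (1 - a) * qpoch (a * p) p n"
  unfolding qpoch_def by (simp add: prod.lessThan_Suc_shift mult.assoc del: prod.lessThan_Suc)

lemma D_mat_eq_diag_matrix:
  "D_mat d q s = diag_matrix d (\<lambda>n. qpoch (s * q powi (int d - 2 * int n + 1)) (q ^ 2) n)"
  by (simp add: D_mat_def diag_matrix_def)

lemma calD_mat_eq_diag_matrix: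
  "calD_mat d q s = diag_matrix d (\<lambda>n. s ^ n * q powi (int n * (int d - 1)))"
  by (simp add: calD_mat_def diag_matrix_def)

context generic_evaluation_module begin

text \<open>
  The base point of the entry \<open>n\<close> of \<open>D_mat\<close> moves with \<open>n\<close> in such a way that
  passing to \<open>n + 1\<close> adds one factor in front. So the entries satisfy the recurrence of
  \<open>adjacent_flag_ratio\<close>; for \<open>inverse q\<close> in place of \<open>q\<close> they satisfy the same
  recurrence read from the other end.
\<close>

lemma qpoch_descending_Suc:
  "qpoch (s * q powi (int d - 2 * int (Suc n) + 1)) (q ^ 2) (Suc n)
   = (1 - s * q powi (int d - 2 * int n - 1)) * qpoch (s * q powi (int d - 2 * int n + 1)) (q ^ 2) n"
proof -
  have e: "int d - 2 * int (Suc n) + 1 = int d - 2 * int n - 1" by simp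
  have "int d - 2 * int n + 1 = (int d - 2 * int n - 1) + 2" by simp
  then have "q powi (int d - 2 * int n + 1) = q powi ((int d - 2 * int n - 1) + 2)"
    by (simp only:)
  also have "\<dots> = q powi (int d - 2 * int n - 1) * q ^ 2"
    using q_nonzero by (subst power_int_add) simp_all
  finally have f: "q powi (int d - 2 * int n + 1) = q powi (int d - 2 * int n - 1) * q ^ 2" .
  show ?thesis unfolding qpoch_Suc_left e f by (simp add: mult.assoc)
qed

lemma qpoch_ascending_Suc:
  "qpoch (s * inverse q powi (int d - 2 * int (Suc n) + 1)) (inverse q ^ 2) (Suc n)
   = (1 - s * q powi (2 * int n + 1 - int d))
     * qpoch (s * inverse q powi (int d - 2 * int n + 1)) (inverse q ^ 2) n"
proof -
  have inv: "inverse q powi e = q powi (- e)" for e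
    by (simp add: power_int_inverse power_int_minus)
  have e: "- (int d - 2 * int (Suc n) + 1) = 2 * int n + 1 - int d" by simp
  have "- (int d - 2 * int n + 1) = (2 * int n + 1 - int d) + - 2" by simp
  then have "q powi (- (int d - 2 * int n + 1)) = q powi ((2 * int n + 1 - int d) + - 2)"
    by (simp only:)
  also have "\<dots> = q powi (2 * int n + 1 - int d) * q powi (- 2)"
    using q_nonzero by (subst power_int_add) simp_all
  also have "q powi (- 2) = inverse q ^ 2"
    by (simp add: power_int_minus power_inverse)
  finally have f: "q powi (- (int d - 2 * int n + 1)) = q powi (2 * int n + 1 - int d) * inverse q ^ 2" .
  show ?thesis unfolding qpoch_Suc_left inv e f by (simp only: mult.assoc)
qed

lemma proportional_components:
  assumes kl: "standard_pair k l" and u: "resolves k l v u"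
    and u0: "\<And>z. z \<in> {0..int d} \<Longrightarrow> u z \<noteq> 0"
  obtains a where "resolves k l v' (\<lambda>z. a z *s u z)"
proof -
  obtain w where w: "resolves k l v' w" using resolves_exists[OF kl] by blast
  have "\<exists>c. w z = c *s u z" for z
  proof (cases "z \<in> {0..int d}")
    case True
    then show ?thesis
      using u w u0 by (intro eig_proportional[OF kl, of _ z]) (auto simp: resolves_def)
  next
    case False
    moreover have "w z \<in> eig k l z" using w by (simp add: resolves_def)
    ultimately have "w z = 0 *s u z" using eig_outside[OF kl] by simp
    then show ?thesis ..
  qed
  then obtain a where "\<And>z. w z = a z *s u z" by metis
  then have "w = (\<lambda>z. a z *s u z)" by blast
  then show thesis using w that by blast
qed

lemma resolves_decomposition:
  assumes "standard_pair k l" "resolves k l v u"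
  shows "u (int n) \<in> decomposition UNIV scale q x d k l n" "v = (\<Sum>n\<le>d. u (int n))"
proof -
  show "u (int n) \<in> decomposition UNIV scale q x d k l n"
    using assms by (simp add: resolves_def decomposition_def eigenspace_on_def eig_def)
  have "(\<Sum>z\<in>{0..int d}. u z) = (\<Sum>n\<le>d. u (int n))"
    by (rule sum.reindex_bij_witness[of _ int nat]) auto
  then show "v = (\<Sum>n\<le>d. u (int n))" using assms(2) by (simp add: resolves_def)
qed

lemma resolves_inverse_decomposition:
  assumes "\<not> standard_pair l k" "resolves k l v u"
  shows "u (int (d - n)) \<in> decomposition UNIV scale q x d l k n" "v = (\<Sum>n\<le>d. u (int (d - n)))"
proof -
  show "u (int (d - n)) \<in> decomposition UNIV scale q x d l k n"
    using assms by (simp add: resolves_def decomposition_def eigenspace_on_def eig_def)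
  have "(\<Sum>z\<in>{0..int d}. u z) = (\<Sum>n\<le>d. u (int (d - n)))"
    by (rule sum.reindex_bij_witness[of _ "\<lambda>n. int (d - n)" "\<lambda>z. d - nat z"]) auto
  then show "v = (\<Sum>n\<le>d. u (int (d - n)))" using assms(2) by (simp add: resolves_def)
qed

text \<open>
  In the third and fourth rows the decomposition is inverted, so there the scalars \<open>a\<close> of the
  first two rows are read from the far end.
\<close>

lemma diagonal_transitions:
  assumes R: "evaluation_relation r s" and R': "evaluation_relation (r + 1) (inverse s)"
    and s: "s \<noteq> 0"
    and \<eta>: "\<And>i. flag_vector i (\<eta> i)" and \<eta>s: "\<And>i. dual_flag_vector i (\<eta>s i)"
  shows
    "let B = normalized_basis scale q x d \<eta>;
         T = is_transition_matrix scale;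
         ip = (\<lambda>i j. \<eta>s j (\<eta> i))
     in
       T (B r (r+1) (r+2) (r+3)) (B (r+1) r (r+2) (r+3))
         ((ip r (r+3) / ip (r+1) (r+3)) \<cdot>\<^sub>m D_mat d q s) \<and>
       T (B (r+1) r (r+2) (r+3)) (B r (r+1) (r+2) (r+3))
         ((ip (r+1) (r+3) / ip r (r+3)) \<cdot>\<^sub>m mat_inv (D_mat d q s)) \<and>
       T (B r (r+1) (r+3) (r+2)) (B (r+1) r (r+3) (r+2))
         ((ip r (r+2) / ip (r+1) (r+2)) \<cdot>\<^sub>m mat_inv (D_mat d (inverse q) s)) \<and>
       T (B (r+1) r (r+3) (r+2)) (B r (r+1) (r+3) (r+2))
         ((ip (r+1) (r+2) / ip r (r+2)) \<cdot>\<^sub>m D_mat d (inverse q) s) \<and>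
       T (B r (r+2) (r+1) (r+3)) (B (r+2) r (r+1) (r+3))
         ((ip r (r+3) / ip (r+2) (r+3)) \<cdot>\<^sub>m calD_mat d q s) \<and>
       T (B (r+2) r (r+1) (r+3)) (B r (r+2) (r+1) (r+3))
         ((ip (r+2) (r+3) / ip r (r+3)) \<cdot>\<^sub>m mat_inv (calD_mat d q s))"
proof -
  have T1: "weyl_triple (r + 1) (r + 2) (r + 3)" "weyl_triple r (r + 2) (r + 3)"
    and T2: "weyl_triple (r + 2) (r + 3) (r + 1)" "weyl_triple r (r + 1) (r + 3)"
    and st: "standard_pair (r + 2) (r + 3)" "standard_pair (r + 1) (r + 3)"
    and nst: "\<not> standard_pair (r + 3) (r + 2)"
    and ne: "r + 2 \<noteq> r + 3" "r + 3 \<noteq> r + 2" "r + 1 \<noteq> r + 3"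
    by (simp_all add: weyl_triple_def standard_pair_def)

  obtain u where u: "resolves (r + 2) (r + 3) (\<eta> (r + 1)) u" using resolves_exists[OF st(1)] by blast
  have u0: "u z \<noteq> 0" if "z \<in> {0..int d}" for z
    by (rule components_nonzero[OF T1(1) \<eta> u that])
  obtain a where a: "resolves (r + 2) (r + 3) (\<eta> r) (\<lambda>z. a z *s u z)"
    by (rule proportional_components[OF st(1) u u0])
  have au0: "a z *s u z \<noteq> 0" if "z \<in> {0..int d}" for z
    by (rule components_nonzero[OF T1(2) \<eta> a that])
  then have a0: "a z \<noteq> 0" if "z \<in> {0..int d}" for z using that by fastforce
  have step: "a (int n + 1) = (1 - s * q powi (int d - 2 * int n - 1)) * a (int n)" if "n < d" for n
    using adjacent_flag_ratio[OF R \<eta> \<eta> u a] that by simp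
  have an: "a (int n) = a (int 0) * qpoch (s * q powi (int d - 2 * int n + 1)) (q ^ 2) n" if "n \<le> d" for n
    using that
  proof (induction n)
    case 0
    then show ?case by (simp add: qpoch_def)
  next
    case (Suc n)
    have "a (int (Suc n)) = (1 - s * q powi (int d - 2 * int n - 1)) * a (int n)"
      using step[of n] Suc.prems by (simp add: add.commute)
    also have "a (int n) = a (int 0) * qpoch (s * q powi (int d - 2 * int n + 1)) (q ^ 2) n"
      using Suc by simp
    finally show ?case unfolding qpoch_descending_Suc by (simp only: mult.left_commute)
  qed
  have down: "a (int (d - n)) * qpoch (s * inverse q powi (int d - 2 * int n + 1)) (inverse q ^ 2) n
      = a (int d)" if "n \<le> d" for n
    using that
  proof (induction n)
    case 0
    then show ?case by (simp add: qpoch_def)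
  next
    case (Suc n)
    have e: "int (d - Suc n) + 1 = int (d - n)"
      "int d - 2 * int (d - Suc n) - 1 = 2 * int n + 1 - int d"
      using Suc.prems by (simp_all add: of_nat_diff)
    have "d - Suc n < d" using Suc.prems by simp
    from step[OF this]
    have s: "a (int (d - n)) = (1 - s * q powi (2 * int n + 1 - int d)) * a (int (d - Suc n))"
      unfolding e .
    have "a (int (d - n)) * qpoch (s * inverse q powi (int d - 2 * int n + 1)) (inverse q ^ 2) n
        = a (int d)"
      using Suc by simp
    then show ?case unfolding qpoch_ascending_Suc s by (simp only: mult_ac)
  qed

  obtain u' where u': "resolves (r + 1) (r + 3) (\<eta> (r + 2)) u'" using resolves_exists[OF st(2)] by blast
  have u'0: "u' z \<noteq> 0" if "z \<in> {0..int d}" for z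
    using components_nonzero[OF T2(1) \<eta> resolves_inverse[OF _ u'], of "int d - z"] that by simp
  obtain b where b: "resolves (r + 1) (r + 3) (\<eta> r) (\<lambda>z. b z *s u' z)"
    by (rule proportional_components[OF st(2) u' u'0])
  have b0: "b z \<noteq> 0" if "z \<in> {0..int d}" for z
    using components_nonzero[OF T2(2) \<eta> b that] by auto
  have bn: "b (int n) = b (int 0) * (s ^ n * q powi (int n * (int d - 1)))" if "n \<le> d" for n
    using that
  proof (induction n)
    case 0
    then show ?case by simp
  next
    case (Suc n)
    have "b (int (Suc n)) = s * q powi (int d - 1) * b (int n)"
      using opposite_flag_ratio[OF R' s \<eta> \<eta> u' b, of "int n"] Suc.prems by (simp add: add.commute)
    also have "b (int n) = b (int 0) * (s ^ n * q powi (int n * (int d - 1)))"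
      using Suc by simp
    also have "s * q powi (int d - 1) * (b (int 0) * (s ^ n * q powi (int n * (int d - 1))))
        = b (int 0) * (s ^ Suc n * (q powi (int d - 1) * q powi (int n * (int d - 1))))"
      by (simp only: power_Suc mult_ac)
    also have "q powi (int d - 1) * q powi (int n * (int d - 1)) = q powi (int (Suc n) * (int d - 1))"
      using q_nonzero by (simp add: distrib_right flip: power_int_add)
    finally show ?case .
  qed

  show ?thesis unfolding Let_def D_mat_eq_diag_matrix calD_mat_eq_diag_matrix
  proof (intro conjI)
    note rows = transition_between_normalized_bases[where \<eta> = \<eta> and j = "r + 1" and j' = r
      and w = "\<lambda>n. u (int n)" and c = "\<lambda>n. a (int n)",
      OF ne(1) \<eta>s _ _ _ resolves_decomposition(2)[OF st(1) u] resolves_decomposition(2)[OF st(1) a]]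
    have w: "u (int n) \<in> decomposition UNIV scale q x d (r + 2) (r + 3) n" for n
      by (rule resolves_decomposition(1)[OF st(1) u])
    show "is_transition_matrix scale
        (normalized_basis scale q x d \<eta> r (r + 1) (r + 2) (r + 3))
        (normalized_basis scale q x d \<eta> (r + 1) r (r + 2) (r + 3))
        ((\<eta>s (r + 3) (\<eta> r) / \<eta>s (r + 3) (\<eta> (r + 1))) \<cdot>\<^sub>m
          diag_matrix d (\<lambda>n. qpoch (s * q powi (int d - 2 * int n + 1)) (q ^ 2) n))"
      by (rule rows(1)) (rule w u0 a0 an | simp)+
    show "is_transition_matrix scale
        (normalized_basis scale q x d \<eta> (r + 1) r (r + 2) (r + 3))
        (normalized_basis scale q x d \<eta> r (r + 1) (r + 2) (r + 3))
        ((\<eta>s (r + 3) (\<eta> (r + 1)) / \<eta>s (r + 3) (\<eta> r)) \<cdot>\<^sub>m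
          mat_inv (diag_matrix d (\<lambda>n. qpoch (s * q powi (int d - 2 * int n + 1)) (q ^ 2) n)))"
      by (rule rows(2)) (rule w u0 a0 an | simp)+
  next
    have w: "a (int (d - n)) *s u (int (d - n)) \<in> decomposition UNIV scale q x d (r + 3) (r + 2) n" for n
      by (rule resolves_inverse_decomposition(1)[OF nst a])
    have \<eta>': "\<eta> (r + 1) = (\<Sum>n\<le>d. inverse (a (int (d - n))) *s a (int (d - n)) *s u (int (d - n)))"
    proof -
      have one: "inverse (a (int (d - n))) * a (int (d - n)) = 1" for n
        using a0[of "int (d - n)"] by simp
      show ?thesis
        unfolding scale_scale one scale_one by (rule resolves_inverse_decomposition(2)[OF nst u])
    qed
    have ia0: "inverse (a (int (d - n))) \<noteq> 0" for n
      using a0[of "int (d - n)"] by simp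
    have c: "inverse (a (int (d - n))) = inverse (a (int (d - 0)))
        * qpoch (s * inverse q powi (int d - 2 * int n + 1)) (inverse q ^ 2) n" if "n \<le> d" for n
      using down[OF that] a0[of "int (d - n)"] a0[of "int d"] by (simp add: field_simps)
    note rows = transition_between_normalized_bases[where \<eta> = \<eta> and j = r and j' = "r + 1"
      and w = "\<lambda>n. a (int (d - n)) *s u (int (d - n))" and c = "\<lambda>n. inverse (a (int (d - n)))",
      OF ne(2) \<eta>s _ _ _ resolves_inverse_decomposition(2)[OF nst a] \<eta>']
    show "is_transition_matrix scale
        (normalized_basis scale q x d \<eta> r (r + 1) (r + 3) (r + 2))
        (normalized_basis scale q x d \<eta> (r + 1) r (r + 3) (r + 2))
        ((\<eta>s (r + 2) (\<eta> r) / \<eta>s (r + 2) (\<eta> (r + 1))) \<cdot>\<^sub>m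
          mat_inv (diag_matrix d
            (\<lambda>n. qpoch (s * inverse q powi (int d - 2 * int n + 1)) (inverse q ^ 2) n)))"
      by (rule rows(2)) (rule w au0 ia0 c | simp)+
    show "is_transition_matrix scale
        (normalized_basis scale q x d \<eta> (r + 1) r (r + 3) (r + 2))
        (normalized_basis scale q x d \<eta> r (r + 1) (r + 3) (r + 2))
        ((\<eta>s (r + 2) (\<eta> (r + 1)) / \<eta>s (r + 2) (\<eta> r)) \<cdot>\<^sub>m
          diag_matrix d
            (\<lambda>n. qpoch (s * inverse q powi (int d - 2 * int n + 1)) (inverse q ^ 2) n))"
      by (rule rows(1)) (rule w au0 ia0 c | simp)+
  next
    have w: "u' (int n) \<in> decomposition UNIV scale q x d (r + 1) (r + 3) n" for n
      by (rule resolves_decomposition(1)[OF st(2) u'])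
    note rows = transition_between_normalized_bases[where \<eta> = \<eta> and j = "r + 2" and j' = r
      and w = "\<lambda>n. u' (int n)" and c = "\<lambda>n. b (int n)",
      OF ne(3) \<eta>s _ _ _ resolves_decomposition(2)[OF st(2) u'] resolves_decomposition(2)[OF st(2) b]]
    show "is_transition_matrix scale
        (normalized_basis scale q x d \<eta> r (r + 2) (r + 1) (r + 3))
        (normalized_basis scale q x d \<eta> (r + 2) r (r + 1) (r + 3))
        ((\<eta>s (r + 3) (\<eta> r) / \<eta>s (r + 3) (\<eta> (r + 2))) \<cdot>\<^sub>m
          diag_matrix d (\<lambda>n. s ^ n * q powi (int n * (int d - 1))))"
      by (rule rows(1)) (rule w u'0 b0 bn | simp)+
    show "is_transition_matrix scale
        (normalized_basis scale q x d \<eta> (r + 2) r (r + 1) (r + 3))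
        (normalized_basis scale q x d \<eta> r (r + 2) (r + 1) (r + 3))
        ((\<eta>s (r + 3) (\<eta> (r + 2)) / \<eta>s (r + 3) (\<eta> r)) \<cdot>\<^sub>m
          mat_inv (diag_matrix d (\<lambda>n. s ^ n * q powi (int n * (int d - 1)))))"
      by (rule rows(2)) (rule w u'0 b0 bn | simp)+
  qed
qed

lemma flag_vector_of_V_flag:
  assumes "v \<in> V_flag scale q x d i 0" "v \<noteq> 0"
  shows "flag_vector i v"
  using assms
  by (auto simp: V_flag_def flag_def decomposition_def standard_pair_def eigenspace_on_def
      flag_vector_def eig_def)

lemma dual_flag_vector_of_dual_flag:
  assumes "f \<in> dual_flag scale q x d i 0" "f \<noteq> 0"
  shows "dual_flag_vector i f"
proof -
  have "f \<in> decomposition (dual_space scale) dual_scale (inverse q) (dual_action x) d i (i + 1) 0"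
    using assms(1) by (auto simp: dual_flag_def flag_def)
  then have lin: "Vector_Spaces.linear scale (*) f"
    and eq: "dual_action x i (i + 1) f = dual_scale (inverse q powi int d) f"
    by (auto simp: decomposition_def standard_pair_def eigenspace_on_def dual_space_def)
  have "f (x i (i + 1) v) = q powi (- int d) * f v" for v
    using fun_cong[OF eq, of v]
    by (simp add: dual_action_def dual_scale_def power_int_minus power_inverse)
  then show ?thesis using lin assms(2) by (simp add: dual_flag_vector_def zero_fun_def)
qed

end

theorem theorem13p1:
  fixes scale :: "'f::alg_closed_field \<Rightarrow> 'v::ab_group_add \<Rightarrow> 'v"
    and q t :: 'f
    and x :: "4 \<Rightarrow> 4 \<Rightarrow> 'v \<Rightarrow> 'v"
    and d :: nat
    and \<eta> :: "4 \<Rightarrow> 'v"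
    and \<eta>s :: "4 \<Rightarrow> 'v \<Rightarrow> 'f"
    and r :: 4
  assumes "q \<noteq> 0"
    and "\<forall>n>0. q ^ n \<noteq> 1"
    and "evaluation_module scale q x d"
    and "evaluation_parameter scale q x d t"
    and "\<forall>i. \<eta> i \<in> V_flag scale q x d i 0 \<and> \<eta> i \<noteq> 0"
    and "\<forall>i. \<eta>s i \<in> dual_flag scale q x d i 0 \<and> \<eta>s i \<noteq> 0"
  shows
    "let B = normalized_basis scale q x d \<eta>;
         T = is_transition_matrix scale;
         ip = (\<lambda>i j. \<eta>s j (\<eta> i));
         s = (if r = 0 \<or> r = 2 then t else inverse t)
     in
       T (B r (r+1) (r+2) (r+3)) (B (r+1) r (r+2) (r+3))
         ((ip r (r+3) / ip (r+1) (r+3)) \<cdot>\<^sub>m D_mat d q s) \<and>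
       T (B (r+1) r (r+2) (r+3)) (B r (r+1) (r+2) (r+3))
         ((ip (r+1) (r+3) / ip r (r+3)) \<cdot>\<^sub>m mat_inv (D_mat d q s)) \<and>
       T (B r (r+1) (r+3) (r+2)) (B (r+1) r (r+3) (r+2))
         ((ip r (r+2) / ip (r+1) (r+2)) \<cdot>\<^sub>m mat_inv (D_mat d (inverse q) s)) \<and>
       T (B (r+1) r (r+3) (r+2)) (B r (r+1) (r+3) (r+2))
         ((ip (r+1) (r+2) / ip r (r+2)) \<cdot>\<^sub>m D_mat d (inverse q) s) \<and>
       T (B r (r+2) (r+1) (r+3)) (B (r+2) r (r+1) (r+3))
         ((ip r (r+3) / ip (r+2) (r+3)) \<cdot>\<^sub>m calD_mat d q s) \<and>
       T (B (r+2) r (r+1) (r+3)) (B r (r+2) (r+1) (r+3))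
         ((ip (r+2) (r+3) / ip r (r+3)) \<cdot>\<^sub>m mat_inv (calD_mat d q s))"
proof -
  interpret evaluation_module scale q x d by (rule assms(3))
  interpret generic_evaluation_module scale q x d
    by unfold_locales (use assms(1,2) in auto)
  have t: "t \<noteq> 0" using assms(4) by (simp add: evaluation_parameter_def)
  define s where "s = (if r = 0 \<or> r = 2 then t else inverse t)"
  have s: "s \<noteq> 0" using t by (simp add: s_def)
  note R0 = evaluation_relations_of_parameter(1)[OF assms(4)]
  note R1 = evaluation_relations_of_parameter(2)[OF assms(4)]
  have R2: "evaluation_relation 2 t" using evaluation_relation_shift[OF R0] by simp
  have R3: "evaluation_relation 3 (inverse t)" using evaluation_relation_shift[OF R1] by simp
  have "evaluation_relation r s \<and> evaluation_relation (r + 1) (inverse s)"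
    using z4_exhaust[of r]
  proof (elim disjE)
    assume r: "r = 3"
    then have "r + 1 = 0" by simp
    then have "evaluation_relation (r + 1) t" using R0 by (simp only:)
    then show ?thesis using R3 r by (simp add: s_def)
  qed (use R0 R1 R2 R3 in \<open>simp_all add: s_def\<close>)
  then show ?thesis
    using diagonal_transitions[of r s \<eta> \<eta>s] s assms(5,6)
      flag_vector_of_V_flag dual_flag_vector_of_dual_flag
    unfolding Let_def s_def[symmetric] by blast
qed

end
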